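(* Let $p$ be an Ising model on $n$ nodes in the high-temperature regime with no external field, with all edge parameters of absolute value at most $\beta$. There is a polynomial-time algorithm which, given $\tilde O\!\left(\frac{n^{10/3}\beta^2}{\varepsilon^2}\right)$ i.i.d. samples from $p$, distinguishes with probability at least $9/10$ between the cases $p\in\mathcal{I}_n$ and $d_{\mathrm{SKL}}(p,\mathcal{I}_n)\ge\varepsilon$.
   Context: An Ising model on vertex set $V$, $|V|=n$, is the distribution on $\{-1,1\}^V$ with $p(x)\propto\exp\big(\sum_{v}\theta_v x_v+\sum_{u\ne v}\theta_{uv}x_ux_v\big)$. "No external field" means $\theta_v=0$ for all $v$. The model is in the high-temperature regime (Dobrushin's uniqueness condition) if $\max_{v\in V}\sum_{u\ne v}\tanh(|\theta_{uv}|)\le1-\eta$ for some constant $\eta>0$. $\mathcal{I}_n$ is the set of product distributions on $\{-1,1\}^n$; $d_{\mathrm{SKL}}(p,q)=d_{\mathrm{KL}}(p\|q)+d_{\mathrm{KL}}(q\|p)$, $d_{\mathrm{SKL}}(p,\mathcal{I}_n)=\min_{q\in\mathcal{I}_n}d_{\mathrm{SKL}}(p,q)$. $\tilde O$ hides polylogarithmic factors. *)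

theory Defs
  imports "HOL-Probability.Probability" "HOL-Library.Log_Nat"
begin

section \<open>Ising models and product distributions\<close>

text \<open>The vertex set is \<open>{..<n}\<close>; configurations are extensional functions on it.\<close>

definition configs :: "nat \<Rightarrow> (nat \<Rightarrow> int) set" where
  "configs n = {..<n} \<rightarrow>\<^sub>E {-1, 1}"

text \<open>
  Each edge contributes once: the interaction sum ranges over unordered pairs.  With this
  normalisation \<open>tanh \<bar>\<theta> u v\<bar>\<close> bounds the influence of \<open>u\<close> on \<open>v\<close>, as Dobrushin's condition
  requires.
\<close>

definition ising_weight ::
  "nat \<Rightarrow> (nat \<Rightarrow> real) \<Rightarrow> (nat \<Rightarrow> nat \<Rightarrow> real) \<Rightarrow> (nat \<Rightarrow> int) \<Rightarrow> real" where
  "ising_weight n h \<theta> x =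
     exp ((\<Sum>v<n. h v * of_int (x v)) + (\<Sum>v<n. \<Sum>u<v. \<theta> u v * of_int (x u) * of_int (x v)))"

definition ising ::
  "nat \<Rightarrow> (nat \<Rightarrow> real) \<Rightarrow> (nat \<Rightarrow> nat \<Rightarrow> real) \<Rightarrow> (nat \<Rightarrow> int) pmf" where
  "ising n h \<theta> = embed_pmf (\<lambda>x. if x \<in> configs n
     then ising_weight n h \<theta> x / (\<Sum>y\<in>configs n. ising_weight n h \<theta> y) else 0)"

definition high_temperature :: "nat \<Rightarrow> real \<Rightarrow> (nat \<Rightarrow> nat \<Rightarrow> real) \<Rightarrow> bool" where
  "high_temperature n \<eta> \<theta> \<longleftrightarrow>
     (MAX v\<in>{..<n}. \<Sum>u\<in>{..<n} - {v}. tanh \<bar>\<theta> u v\<bar>) \<le> 1 - \<eta>"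

definition product_dists :: "nat \<Rightarrow> (nat \<Rightarrow> int) pmf set" where
  "product_dists n =
     {Pi_pmf {..<n} undefined q | q. \<forall>v<n. set_pmf (q v) \<subseteq> {-1, 1}}"

lemma finite_configs [simp]: "finite (configs n)"
  unfolding configs_def by (intro finite_PiE) auto

lemma configs_nonempty [simp]: "configs n \<noteq> {}"
  unfolding configs_def by (simp add: PiE_eq_empty_iff)

lemma pmf_ising:
  "pmf (ising n h \<theta>) x = (if x \<in> configs n
     then ising_weight n h \<theta> x / (\<Sum>y\<in>configs n. ising_weight n h \<theta> y) else 0)"
proof -
  define Z where "Z = (\<Sum>y\<in>configs n. ising_weight n h \<theta> y)"
  define f where "f x = (if x \<in> configs n then ising_weight n h \<theta> x / Z else 0)" for x
  have Z: "Z > 0"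
    unfolding Z_def by (intro sum_pos) (auto simp: ising_weight_def)
  have nonneg: "f x \<ge> 0" for x
    using Z by (simp add: f_def ising_weight_def)
  have "(\<integral>\<^sup>+x. ennreal (f x) \<partial>count_space UNIV) = (\<Sum>x\<in>configs n. ennreal (f x))"
    by (rule nn_integral_count_space'[OF finite_configs]) (auto simp: f_def)
  also have "\<dots> = ennreal (\<Sum>x\<in>configs n. f x)"
    by (rule sum_ennreal) (simp add: nonneg)
  also have "(\<Sum>x\<in>configs n. f x) = 1"
    using Z by (simp add: f_def flip: sum_divide_distrib Z_def)
  finally have "pmf (embed_pmf f) x = f x"
    by (intro pmf_embed_pmf nonneg) simp
  then show ?thesis
    unfolding ising_def f_def Z_def by simp
qed

section \<open>Divergences\<close>

text \<open>
  \<open>KL_divergence b M N\<close> is the divergence of \<open>N\<close> from \<open>M\<close>, and is only meaningful when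
  \<open>N\<close> is absolutely continuous with respect to \<open>M\<close>.
\<close>

definition d_KL :: "'a pmf \<Rightarrow> 'a pmf \<Rightarrow> ereal" where
  "d_KL p q = (if set_pmf p \<subseteq> set_pmf q
     then ereal (KL_divergence (exp 1) (measure_pmf q) (measure_pmf p)) else \<infinity>)"

definition d_SKL :: "'a pmf \<Rightarrow> 'a pmf \<Rightarrow> ereal" where
  "d_SKL p q = d_KL p q + d_KL q p"

definition d_SKL_set :: "'a pmf \<Rightarrow> 'a pmf set \<Rightarrow> ereal" where
  "d_SKL_set p Q = (INF q\<in>Q. d_SKL p q)"

lemma d_KL_finite:
  assumes fin: "finite (set_pmf q)" and sub: "set_pmf p \<subseteq> set_pmf q"
  shows "d_KL p q = ereal (\<Sum>x\<in>set_pmf p. pmf p x * ln (pmf p x / pmf q x))"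
proof -
  let ?f = "\<lambda>x. pmf p x / pmf q x"
  have eq: "measure_pmf p = density (measure_pmf q) (\<lambda>x. ennreal (?f x))"
  proof (rule measure_eqI)
    fix A assume "A \<in> sets (measure_pmf p)"
    have "emeasure (density (measure_pmf q) (\<lambda>x. ennreal (?f x))) A
        = (\<integral>\<^sup>+x. ennreal (?f x) * indicator A x \<partial>measure_pmf q)"
      by (simp add: emeasure_density)
    also have "\<dots> = (\<integral>\<^sup>+x. ennreal (pmf q x) * (ennreal (?f x) * indicator A x) \<partial>count_space UNIV)"
      by (simp add: nn_integral_measure_pmf)
    also have "\<dots> = (\<integral>\<^sup>+x. ennreal (pmf p x) * indicator A x \<partial>count_space UNIV)"
    proof (intro nn_integral_cong)
      fix x
      show "ennreal (pmf q x) * (ennreal (?f x) * indicator A x)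
          = ennreal (pmf p x) * indicator A x"
      proof (cases "x \<in> set_pmf q")
        case True
        then have "pmf q x > 0" by (simp add: pmf_positive)
        then show ?thesis
          by (simp add: mult.assoc[symmetric] flip: ennreal_mult)
      next
        case False
        then have "pmf p x = 0" "pmf q x = 0" using sub by (auto simp: set_pmf_iff)
        then show ?thesis by simp
      qed
    qed
    also have "\<dots> = (\<integral>\<^sup>+x. indicator A x \<partial>measure_pmf p)"
      by (simp add: nn_integral_measure_pmf)
    also have "\<dots> = emeasure (measure_pmf p) A" by simp
    finally show "emeasure (measure_pmf p) A
        = emeasure (density (measure_pmf q) (\<lambda>x. ennreal (?f x))) A" by simp
  qed simp
  have "KL_divergence (exp 1) (measure_pmf q) (measure_pmf p)
      = (\<integral>x. ?f x * log (exp 1) (?f x) \<partial>measure_pmf q)"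
    by (subst eq, rule sigma_finite_measure.KL_density)
       (auto intro: prob_space_imp_sigma_finite prob_space_measure_pmf)
  also have "\<dots> = (\<Sum>x\<in>set_pmf q. pmf q x * (?f x * ln (?f x)))"
    by (subst integral_measure_pmf_real[OF fin]) (auto simp: log_def mult.commute)
  also have "\<dots> = (\<Sum>x\<in>set_pmf p. pmf p x * ln (?f x))"
    by (rule sum.mono_neutral_cong_right) (use fin sub in \<open>auto simp: set_pmf_iff\<close>)
  finally show ?thesis using sub by (simp add: d_KL_def)
qed

section \<open>Polynomial-time computation\<close>

text \<open>
  The machine model is a structured random access machine under the logarithmic cost criterion,
  which is polynomially equivalent to Turing machines.  Memory cells are addressed by integers
  and hold integers, and every address and value that is computed is charged its bit length.
  Conditions test for strict positivity.
\<close>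

type_synonym memory = "int \<Rightarrow> int"

definition bits :: "int \<Rightarrow> nat" where
  "bits z = Suc (floorlog 2 (nat \<bar>z\<bar>))"

datatype expr =
  Const int | Load expr | Plus expr expr | Minus expr expr | Times expr expr | Div expr expr

fun eval_expr :: "expr \<Rightarrow> memory \<Rightarrow> int" where
  "eval_expr (Const z) s = z"
| "eval_expr (Load a) s = s (eval_expr a s)"
| "eval_expr (Plus a b) s = eval_expr a s + eval_expr b s"
| "eval_expr (Minus a b) s = eval_expr a s - eval_expr b s"
| "eval_expr (Times a b) s = eval_expr a s * eval_expr b s"
| "eval_expr (Div a b) s = eval_expr a s div eval_expr b s"

fun cost_expr :: "expr \<Rightarrow> memory \<Rightarrow> nat" where
  "cost_expr (Const z) s = bits z"
| "cost_expr (Load a) s = cost_expr a s + bits (eval_expr (Load a) s)"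
| "cost_expr (Plus a b) s = cost_expr a s + cost_expr b s + bits (eval_expr (Plus a b) s)"
| "cost_expr (Minus a b) s = cost_expr a s + cost_expr b s + bits (eval_expr (Minus a b) s)"
| "cost_expr (Times a b) s = cost_expr a s + cost_expr b s + bits (eval_expr (Times a b) s)"
| "cost_expr (Div a b) s = cost_expr a s + cost_expr b s + bits (eval_expr (Div a b) s)"

datatype prog =
  Skip | Store expr expr | Seq prog prog | If expr prog prog | While expr prog

text \<open>\<open>exec c s t s'\<close>: started in memory \<open>s\<close>, the program \<open>c\<close> halts in memory \<open>s'\<close> at cost \<open>t\<close>.\<close>

inductive exec :: "prog \<Rightarrow> memory \<Rightarrow> nat \<Rightarrow> memory \<Rightarrow> bool" where
  Skip: "exec Skip s 1 s"
| Store: "exec (Store a b) s (1 + cost_expr a s + cost_expr b s)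
            (s(eval_expr a s := eval_expr b s))"
| Seq: "exec c\<^sub>1 s t\<^sub>1 s' \<Longrightarrow> exec c\<^sub>2 s' t\<^sub>2 s'' \<Longrightarrow> exec (Seq c\<^sub>1 c\<^sub>2) s (1 + t\<^sub>1 + t\<^sub>2) s''"
| IfTrue: "eval_expr b s > 0 \<Longrightarrow> exec c\<^sub>1 s t s' \<Longrightarrow>
            exec (If b c\<^sub>1 c\<^sub>2) s (1 + cost_expr b s + t) s'"
| IfFalse: "eval_expr b s \<le> 0 \<Longrightarrow> exec c\<^sub>2 s t s' \<Longrightarrow>
            exec (If b c\<^sub>1 c\<^sub>2) s (1 + cost_expr b s + t) s'"
| WhileFalse: "eval_expr b s \<le> 0 \<Longrightarrow> exec (While b c) s (1 + cost_expr b s) s"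
| WhileTrue: "eval_expr b s > 0 \<Longrightarrow> exec c s t\<^sub>1 s' \<Longrightarrow> exec (While b c) s' t\<^sub>2 s'' \<Longrightarrow>
            exec (While b c) s (1 + cost_expr b s + t\<^sub>1 + t\<^sub>2) s''"

inductive_cases exec_SkipE: "exec Skip s t s'"
inductive_cases exec_StoreE: "exec (Store a b) s t s'"
inductive_cases exec_SeqE: "exec (Seq c\<^sub>1 c\<^sub>2) s t s'"
inductive_cases exec_IfE: "exec (If b c\<^sub>1 c\<^sub>2) s t s'"
inductive_cases exec_WhileE: "exec (While b c) s t s'"

lemma exec_deterministic:
  "exec c s t s' \<Longrightarrow> exec c s u s'' \<Longrightarrow> u = t \<and> s'' = s'"
proof (induction arbitrary: u s'' rule: exec.induct)
  case (Skip s)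
  then show ?case by (rule exec_SkipE) simp
next
  case (Store a s b)
  then show ?case by (rule exec_StoreE) simp
next
  case (Seq c\<^sub>1 s t\<^sub>1 s' c\<^sub>2 t\<^sub>2 r)
  from Seq.prems show ?case
    by (rule exec_SeqE) (auto dest!: Seq.IH)
next
  case (IfTrue b s c\<^sub>1 t s' c\<^sub>2)
  from IfTrue.prems show ?case
    by (rule exec_IfE) (use IfTrue.hyps in \<open>auto dest!: IfTrue.IH\<close>)
next
  case (IfFalse b s c\<^sub>2 t s' c\<^sub>1)
  from IfFalse.prems show ?case
    by (rule exec_IfE) (use IfFalse.hyps in \<open>auto dest!: IfFalse.IH\<close>)
next
  case (WhileFalse b s c)
  from WhileFalse.prems show ?case
    by (rule exec_WhileE) (use WhileFalse.hyps in auto)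
next
  case (WhileTrue b s c t\<^sub>1 s' t\<^sub>2 r)
  from WhileTrue.prems show ?case
    by (rule exec_WhileE) (use WhileTrue.hyps(1) in \<open>auto dest!: WhileTrue.IH\<close>)
qed

text \<open>
  The input consists of \<open>n\<close>, the number of samples, two rational parameters \<open>b\<close> and \<open>e\<close> (as
  numerators and denominators), and the samples.  It is stored from address 0 on; all other
  cells are 0.
\<close>

definition input_word :: "nat \<Rightarrow> rat \<Rightarrow> rat \<Rightarrow> (nat \<Rightarrow> int) list \<Rightarrow> int list" where
  "input_word n b e xs =
     [int n, int (length xs), fst (quotient_of b), snd (quotient_of b),
      fst (quotient_of e), snd (quotient_of e)] @
     concat (map (\<lambda>x. map x [0..<n]) xs)"

definition initial_memory :: "int list \<Rightarrow> memory" where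
  "initial_memory w a = (if 0 \<le> a \<and> a < int (length w) then w ! nat a else 0)"

definition input_size :: "int list \<Rightarrow> nat" where
  "input_size w = sum_list (map bits w)"

text \<open>
  A single program must serve all numbers of vertices, all parameters and all numbers of samples.
  It reports its decision in cell 0.
\<close>

definition poly_time_tester ::
  "(nat \<Rightarrow> rat \<Rightarrow> rat \<Rightarrow> (nat \<Rightarrow> int) list \<Rightarrow> bool) \<Rightarrow> bool" where
  "poly_time_tester A \<longleftrightarrow> (\<exists>c K d. \<forall>n b e xs.
     n \<ge> 1 \<longrightarrow> b \<ge> 0 \<longrightarrow> e > 0 \<longrightarrow> set xs \<subseteq> configs n \<longrightarrow>
     (let w = input_word n b e xs
      in \<exists>t s. exec c (initial_memory w) t s \<and> t \<le> K * input_size w ^ d \<and>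
               (A n b e xs \<longleftrightarrow> s 0 = 1)))"

text \<open>
  \<open>g\<close> is \<open>O~(f)\<close>, in the sense of \<open>O(f log^k f)\<close>, when \<open>g \<le> soft_O C k f\<close> for some fixed \<open>C\<close>
  and \<open>k\<close>.  The shift by 3 keeps the logarithm above 1.
\<close>

definition soft_O :: "real \<Rightarrow> nat \<Rightarrow> real \<Rightarrow> real" where
  "soft_O C k f = C * f * ln (3 + f) ^ k"

text \<open>
  The real parameters \<open>\<beta>\<close> and \<open>\<epsilon>\<close> reach the program as rationals \<open>b \<in> [\<beta>, 2\<beta>]\<close> and
  \<open>e \<in> [\<epsilon>/2, \<epsilon>]\<close>; for rational parameters this includes the exact values.
\<close>

definition approx_params :: "real \<Rightarrow> real \<Rightarrow> rat \<Rightarrow> rat \<Rightarrow> bool" where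
  "approx_params \<beta> \<epsilon> b e \<longleftrightarrow>
     \<beta> \<le> of_rat b \<and> of_rat b \<le> 2 * \<beta> \<and> \<epsilon> / 2 \<le> of_rat e \<and> of_rat e \<le> \<epsilon>"

end

theory Submission
  imports Defs
begin

text \<open>
  A product Ising model with no external field has uncorrelated spins. In general,
  \<open>d_SKL p uniform = (\<Sum>u<v. \<theta> u v * E (x u * x v))\<close>. If this is at least \<open>\<epsilon>\<close>, then
  Cauchy-Schwarz forces the off-diagonal correlation energy
  \<open>\<mu> = (\<Sum>u\<noteq>v. (E (x u * x v))\<^sup>2)\<close> to be at least \<open>4 * (\<epsilon> / (n * \<beta>))\<^sup>2\<close>.
  The U-statistic over pairs of samples with kernel \<open>(x \<bullet> y)\<^sup>2 - n\<close> estimates \<open>\<mu>\<close> without bias.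

  Its variance is controlled by the Poincare inequality for Glauber dynamics, which follows from the
  contraction of oscillations under Dobrushin's condition: applied to linear and then to quadratic
  functions, it bounds the variance of \<open>\<Sum>u v. a u v * x u * x v\<close> by a constant times
  \<open>\<Sum>u v. (a u v)\<^sup>2\<close>. Chebyshev's inequality then needs only
  \<open>O (n\<^sup>3 * \<beta>\<^sup>2 / \<epsilon>\<^sup>2)\<close> samples, with no logarithmic factor.
\<close>

section \<open>The Poincare inequality under Dobrushin's condition\<close>

text \<open>Dobrushin's condition contracts oscillations, a sup-norm quantity, whereas Chebyshev
  needs variances. The passage works because heat-bath dynamics is reversible: for a self-adjoint
  operator, the asymptotic decay rate of the norms already bounds a single step. Quadratic forms
  need the Poincare inequality twice because flipping one spin changes such a form by a linear one.

  The power of n comes from the Hoeffding split of the kernel into \<mu>, a linear part of variance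
  O(\<mu>) and a degenerate part of variance O(n^2). Summed over the pairs of m samples these
  contribute O(m^3 \<mu>) and O(m^2 n^2), against a squared signal of order (m^2 \<mu>)^2. So m of
  order n / \<mu> suffices; at the smallest \<mu> of the far case this is n^3 \<beta>^2 /
  \<epsilon>^2, below the allowed n^(10/3). The linear part must be bounded in terms of \<mu>
  itself: it then disappears in the product case, where \<mu> = 0.\<close>

definition flip :: "nat \<Rightarrow> (nat \<Rightarrow> int) \<Rightarrow> nat \<Rightarrow> int" where
  "flip i x = x(i := - x i)"

lemma flip_flip [simp]: "flip i (flip i x) = x"
  by (simp add: flip_def)

lemma flip_commute: "flip i (flip j x) = flip j (flip i x)"
  by (auto simp: flip_def fun_eq_iff)

lemma flip_in_configs [simp]: "i < n \<Longrightarrow> x \<in> configs n \<Longrightarrow> flip i x \<in> configs n"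
  by (auto simp: flip_def configs_def PiE_iff extensional_def)

lemma sum_flip:
  assumes "i < n"
  shows "(\<Sum>x\<in>configs n. f (flip i x)) = (\<Sum>x\<in>configs n. f x)"
  by (rule sum.reindex_bij_witness[of _ "flip i" "flip i"]) (use assms in auto)

text \<open>Log-convexity makes the ratios \<open>b (Suc k) / b k\<close> nondecreasing. A first
  ratio \<open>r > s\<close> would therefore persist and force growth like \<open>r ^ k\<close>,
  against the decay assumed, whatever the size of \<open>D\<close>.\<close>

lemma log_convex_ratio_le:
  fixes b :: "nat \<Rightarrow> real"
  assumes nonneg: "\<And>k. 0 \<le> b k"
    and convex: "\<And>k. (b (Suc k))\<^sup>2 \<le> b k * b (Suc (Suc k))"
    and s: "0 \<le> s" and decay: "\<And>k. b k \<le> D * s ^ k"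
  shows "b 1 \<le> s * b 0"
proof (rule ccontr)
  assume "\<not> b 1 \<le> s * b 0"
  then have gt: "s * b 0 < b 1" by simp
  have b1: "b 1 > 0" using gt s nonneg[of 0] by (smt (verit) mult_nonneg_nonneg)
  then have b0: "b 0 > 0"
    using convex[of 0] nonneg[of 0] by (cases "b 0 = 0") auto
  define r where "r = b 1 / b 0"
  have r: "r > s" "r > 0" using gt b0 b1 by (simp_all add: r_def field_simps)
  have step: "b k > 0 \<and> b (Suc k) \<ge> r * b k" for k
  proof (induction k)
    case 0 then show ?case using b0 by (simp add: r_def)
  next
    case (Suc k)
    then have pos: "b (Suc k) > 0" using r by (smt (verit) mult_pos_pos)
    have "r * b k * b (Suc k) \<le> (b (Suc k))\<^sup>2"
      using Suc pos by (simp add: power2_eq_square)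
    also have "\<dots> \<le> b k * b (Suc (Suc k))" by (rule convex)
    finally have "b k * (r * b (Suc k)) \<le> b k * b (Suc (Suc k))" by (simp add: mult_ac)
    then show ?case using Suc pos by simp
  qed
  have grow: "b 0 * r ^ k \<le> b k" for k
  proof (induction k)
    case (Suc k)
    have "b 0 * r ^ Suc k \<le> r * b k" using Suc r by (simp add: mult_ac)
    then show ?case using step[of k] by linarith
  qed simp
  have "b 0 \<le> D * (s / r) ^ k" for k
  proof -
    have "b 0 * r ^ k \<le> D * s ^ k" using grow[of k] decay[of k] by linarith
    then show ?thesis using r by (simp add: power_divide field_simps)
  qed
  moreover have "(\<lambda>k. D * (s / r) ^ k) \<longlonglongrightarrow> D * 0"
    by (intro tendsto_mult tendsto_const LIMSEQ_realpow_zero) (use r s in auto)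
  ultimately have "b 0 \<le> D * 0"
    by (intro LIMSEQ_le_const) auto
  with b0 show False by simp
qed

text \<open>Hybrid argument: the coordinates of \<open>x\<close> are replaced by those of
  \<open>y\<close> one at a time, and each replacement is either void or a single flip.\<close>

lemma configs_flip_path:
  fixes d :: "nat \<Rightarrow> real"
  assumes osc: "\<And>x j. x \<in> configs n \<Longrightarrow> j < n \<Longrightarrow> \<bar>f x - f (flip j x)\<bar> \<le> d j"
    and x: "x \<in> configs n" and y: "y \<in> configs n"
  shows "\<bar>f x - f y\<bar> \<le> (\<Sum>j<n. d j)"
proof -
  have dnn: "0 \<le> d j" if "j < n" for j
    using osc[OF x that] by linarith
  define z where "z k = (\<lambda>i. if i < k then y i else x i)" for k
  have zc: "z k \<in> configs n" if "k \<le> n" for k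
    using x y that by (auto simp: z_def configs_def PiE_iff extensional_def)
  have step: "\<bar>f (z k) - f (z (Suc k))\<bar> \<le> d k" if k: "k < n" for k
  proof (cases "x k = y k")
    case True
    then have "z k = z (Suc k)" by (auto simp: z_def fun_eq_iff less_Suc_eq)
    then show ?thesis using dnn[OF k] by simp
  next
    case False
    have "x k \<in> {-1,1}" "y k \<in> {-1,1}" using x y k by (auto simp: configs_def PiE_iff)
    with False have "y k = - x k" by auto
    then have "z (Suc k) = flip k (z k)" by (auto simp: z_def flip_def fun_eq_iff less_Suc_eq)
    then show ?thesis using osc[OF zc, of k k] k by simp
  qed
  have "\<bar>f (z 0) - f (z k)\<bar> \<le> (\<Sum>j<k. d j)" if "k \<le> n" for k
    using that
  proof (induction k)
    case (Suc k)
    then show ?case using step[of k] by simp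
  qed simp
  from this[of n] have "\<bar>f (z 0) - f (z n)\<bar> \<le> (\<Sum>j<n. d j)" by simp
  moreover have "z 0 = x" by (simp add: z_def)
  moreover have "z n = y" using x y by (auto simp: z_def fun_eq_iff configs_def PiE_iff extensional_def)
  ultimately show ?thesis by simp
qed

text \<open>A positive probability weight on the cube. \<open>q i x\<close> is the chance that the
  heat bath at site \<open>i\<close> flips that spin, and \<open>R i j\<close> bounds the influence
  of spin \<open>j\<close> on the conditional law at site \<open>i\<close>.\<close>

locale dobrushin_cube =
  fixes n :: nat and w :: "(nat \<Rightarrow> int) \<Rightarrow> real" and R :: "nat \<Rightarrow> nat \<Rightarrow> real"
    and q :: "nat \<Rightarrow> (nat \<Rightarrow> int) \<Rightarrow> real" and \<eta> :: real
  assumes n: "0 < n" and eta: "0 < \<eta>"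
    and w_pos: "\<And>x. x \<in> configs n \<Longrightarrow> 0 < w x"
    and w_sum: "(\<Sum>x\<in>configs n. w x) = 1"
    and q_eq: "\<And>i x. i < n \<Longrightarrow> x \<in> configs n \<Longrightarrow> q i x = w (flip i x) / (w x + w (flip i x))"
    and influence: "\<And>i j x. i < n \<Longrightarrow> j < n \<Longrightarrow> i \<noteq> j \<Longrightarrow> x \<in> configs n \<Longrightarrow>
       \<bar>q i x - q i (flip j x)\<bar> \<le> R i j"
    and row_sum: "\<And>i. i < n \<Longrightarrow> (\<Sum>j\<in>{..<n} - {i}. R i j) \<le> 1 - \<eta>"
begin

section \<open>Single-site resampling, reversibility and the Dirichlet form\<close>

definition ex :: "((nat \<Rightarrow> int) \<Rightarrow> real) \<Rightarrow> real" where
  "ex f = (\<Sum>x\<in>configs n. w x * f x)"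

text \<open>On configurations this is the conditional expectation of \<open>f\<close> given all
  spins except the one at \<open>i\<close>.\<close>

definition resample :: "nat \<Rightarrow> ((nat \<Rightarrow> int) \<Rightarrow> real) \<Rightarrow> (nat \<Rightarrow> int) \<Rightarrow> real" where
  "resample i f x = f x + q i x * (f (flip i x) - f x)"

definition glauber :: "((nat \<Rightarrow> int) \<Rightarrow> real) \<Rightarrow> (nat \<Rightarrow> int) \<Rightarrow> real" where
  "glauber f x = (\<Sum>i<n. resample i f x) / real n"

lemma ex_cong: "(\<And>x. x \<in> configs n \<Longrightarrow> f x = g x) \<Longrightarrow> ex f = ex g"
  by (simp add: ex_def)

lemma ex_mono: "(\<And>x. x \<in> configs n \<Longrightarrow> f x \<le> g x) \<Longrightarrow> ex f \<le> ex g"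
  unfolding ex_def by (intro sum_mono mult_left_mono) (auto intro: less_imp_le w_pos)

lemma ex_const [simp]: "ex (\<lambda>_. c) = c"
  by (simp add: ex_def w_sum flip: sum_distrib_right)

lemma ex_diff: "ex (\<lambda>x. f x - g x) = ex f - ex g"
  by (simp add: ex_def ring_distribs sum_subtractf)

lemma ex_cmult: "ex (\<lambda>x. c * f x) = c * ex f"
  by (simp add: ex_def sum_distrib_left mult_ac)

lemma ex_divide: "ex (\<lambda>x. f x / c) = ex f / c"
  by (simp add: ex_def sum_divide_distrib)

lemma ex_sum: "ex (\<lambda>x. \<Sum>i\<in>I. f i x) = (\<Sum>i\<in>I. ex (f i))"
  by (simp add: ex_def sum_distrib_left sum.swap[of _ _ I])

lemma ex_nonneg: "(\<And>x. x \<in> configs n \<Longrightarrow> 0 \<le> f x) \<Longrightarrow> 0 \<le> ex f"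
  using ex_mono[of "\<lambda>_. 0" f] by simp

lemma ex_Cauchy_Schwarz: "(ex (\<lambda>x. f x * g x))\<^sup>2 \<le> ex (\<lambda>x. (f x)\<^sup>2) * ex (\<lambda>x. (g x)\<^sup>2)"
proof -
  have "(\<Sum>x\<in>configs n. (sqrt (w x) * f x) * (sqrt (w x) * g x))\<^sup>2
     \<le> (\<Sum>x\<in>configs n. (sqrt (w x) * f x)\<^sup>2) * (\<Sum>x\<in>configs n. (sqrt (w x) * g x)\<^sup>2)"
    by (rule Cauchy_Schwarz_ineq_sum)
  moreover have "(\<Sum>x\<in>configs n. (sqrt (w x) * f x) * (sqrt (w x) * g x)) = ex (\<lambda>x. f x * g x)"
    unfolding ex_def
    by (intro sum.cong refl) (use w_pos in \<open>simp add: algebra_simps less_imp_le flip: power2_eq_square real_sqrt_mult\<close>)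
  moreover have "(\<Sum>x\<in>configs n. (sqrt (w x) * h x)\<^sup>2) = ex (\<lambda>x. (h x)\<^sup>2)" for h
    unfolding ex_def
    by (intro sum.cong refl) (use w_pos in \<open>simp add: power_mult_distrib less_imp_le\<close>)
  ultimately show ?thesis by simp
qed

text \<open>Detailed balance: both sides are the product of the two weights divided by their
  sum.\<close>

lemma wq_flip: "i < n \<Longrightarrow> x \<in> configs n \<Longrightarrow> w (flip i x) * q i (flip i x) = w x * q i x"
  by (simp add: q_eq add.commute mult.commute)

lemma q_flip: "i < n \<Longrightarrow> x \<in> configs n \<Longrightarrow> q i (flip i x) = 1 - q i x"
  using w_pos[of x] w_pos[of "flip i x"] by (simp add: q_eq field_simps)

lemma q_nonneg: "i < n \<Longrightarrow> x \<in> configs n \<Longrightarrow> 0 \<le> q i x"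
  and q_le_1: "i < n \<Longrightarrow> x \<in> configs n \<Longrightarrow> q i x \<le> 1"
  using w_pos[of x] w_pos[of "flip i x"] by (simp_all add: q_eq field_simps less_imp_le)

lemma R_nonneg: "i < n \<Longrightarrow> j < n \<Longrightarrow> i \<noteq> j \<Longrightarrow> 0 \<le> R i j"
  using influence[of i j] configs_nonempty[of n] by (metis abs_ge_zero equals0I order_trans)

text \<open>A row sum of nonnegative influences is at most \<open>1 - \<eta>\<close>. This keeps the
  contraction factor \<open>1 - \<eta> / real n\<close> nonnegative.\<close>

lemma eta_le_1: "\<eta> \<le> 1"
  using row_sum[OF n] sum_nonneg[of "{..<n} - {0}" "R 0"] R_nonneg[OF n] by force

text \<open>Averaging the sum with its image under the flip at \<open>i\<close>, detailed balance
  turns it into a Dirichlet form. Its symmetry in \<open>f\<close> and \<open>g\<close> yields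
  self-adjointness, and taking \<open>g\<close> constant yields invariance of the mean.\<close>

lemma ex_resample_diff:
  assumes i: "i < n"
  shows "ex (\<lambda>x. g x * (f x - resample i f x))
    = ex (\<lambda>x. q i x * (f x - f (flip i x)) * (g x - g (flip i x))) / 2"
proof -
  let ?F = "\<lambda>x. w x * q i x * (f x - f (flip i x)) * g x"
  have "ex (\<lambda>x. g x * (f x - resample i f x)) = (\<Sum>x\<in>configs n. ?F x)"
    unfolding ex_def resample_def by (intro sum.cong) (auto simp: algebra_simps)
  moreover have "(\<Sum>x\<in>configs n. ?F x) = (\<Sum>x\<in>configs n. ?F (flip i x))"
    by (rule sum_flip[OF i, symmetric])
  moreover have "(\<Sum>x\<in>configs n. ?F (flip i x))
      = (\<Sum>x\<in>configs n. w x * q i x * (f (flip i x) - f x) * g (flip i x))"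
    by (intro sum.cong) (use i in \<open>auto simp: wq_flip\<close>)
  ultimately have "2 * ex (\<lambda>x. g x * (f x - resample i f x))
      = (\<Sum>x\<in>configs n. ?F x) + (\<Sum>x\<in>configs n. w x * q i x * (f (flip i x) - f x) * g (flip i x))"
    by simp
  also have "\<dots> = ex (\<lambda>x. q i x * (f x - f (flip i x)) * (g x - g (flip i x)))"
    unfolding ex_def sum.distrib[symmetric] by (intro sum.cong) (auto simp: algebra_simps)
  finally show ?thesis by simp
qed

lemma ex_glauber_diff:
  "ex (\<lambda>x. g x * (f x - glauber f x))
    = (\<Sum>i<n. ex (\<lambda>x. q i x * (f x - f (flip i x)) * (g x - g (flip i x)))) / (2 * real n)"
proof -
  have "ex (\<lambda>x. g x * (f x - glauber f x)) = ex (\<lambda>x. (\<Sum>i<n. g x * (f x - resample i f x)) / real n)"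
    using n by (intro ex_cong)
      (simp add: glauber_def sum_subtractf field_simps flip: sum_distrib_left)
  also have "\<dots> = (\<Sum>i<n. ex (\<lambda>x. g x * (f x - resample i f x))) / real n"
    by (simp add: ex_divide ex_sum)
  also have "\<dots> = (\<Sum>i<n. ex (\<lambda>x. q i x * (f x - f (flip i x)) * (g x - g (flip i x)))) / (2 * real n)"
    by (simp add: ex_resample_diff flip: sum_divide_distrib)
  finally show ?thesis .
qed

lemma glauber_self_adjoint: "ex (\<lambda>x. g x * glauber f x) = ex (\<lambda>x. glauber g x * f x)"
proof -
  have "ex (\<lambda>x. g x * (f x - glauber f x)) = ex (\<lambda>x. f x * (g x - glauber g x))"
    unfolding ex_glauber_diff by (simp add: mult_ac)
  then show ?thesis
    by (simp add: right_diff_distrib ex_diff mult.commute)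
qed

lemma ex_glauber: "ex (glauber f) = ex f"
proof -
  have "ex (\<lambda>x. 1 * (f x - glauber f x)) = 0"
    by (subst ex_glauber_diff) simp
  then show ?thesis by (simp add: ex_diff)
qed

text \<open>Resampling at \<open>i\<close> forgets the spin at \<open>i\<close>, hence the zero. For
  \<open>j\<close> different from \<open>i\<close>, the terms with the flip probability held fixed
  form a convex combination of differences across a flip at \<open>j\<close>; the change of that
  probability multiplies a difference across a flip at \<open>i\<close>.\<close>

lemma resample_osc:
  assumes osc: "\<And>x j. x \<in> configs n \<Longrightarrow> j < n \<Longrightarrow> \<bar>f x - f (flip j x)\<bar> \<le> d j"
    and i: "i < n" and j: "j < n" and x: "x \<in> configs n"
  shows "\<bar>resample i f x - resample i f (flip j x)\<bar> \<le> (if i = j then 0 else d j + R i j * d i)"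
proof (cases "i = j")
  case True
  then show ?thesis using i x by (simp add: resample_def q_flip algebra_simps)
next
  case False
  define Q where "Q = q i x"
  define Q' where "Q' = q i (flip j x)"
  define D1 where "D1 = f x - f (flip j x)"
  define D2 where "D2 = f (flip i x) - f (flip j (flip i x))"
  define D3 where "D3 = f (flip i (flip j x)) - f (flip j x)"
  have "resample i f x - resample i f (flip j x) = (1 - Q) * D1 + Q * D2 + (Q - Q') * D3"
    by (simp add: resample_def Q_def Q'_def D1_def D2_def D3_def flip_commute[of i j] algebra_simps)
  also have "\<bar>\<dots>\<bar> \<le> \<bar>(1 - Q) * D1\<bar> + \<bar>Q * D2\<bar> + \<bar>(Q - Q') * D3\<bar>" by linarith
  also have "\<dots> \<le> (1 - Q) * d j + Q * d j + R i j * d i"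
  proof (intro add_mono)
    have Q: "0 \<le> Q" "Q \<le> 1" using q_nonneg q_le_1 i x by (auto simp: Q_def)
    show "\<bar>(1 - Q) * D1\<bar> \<le> (1 - Q) * d j"
      using Q osc[OF x j] by (simp add: abs_mult D1_def mult_left_mono)
    show "\<bar>Q * D2\<bar> \<le> Q * d j"
      using Q osc[of "flip i x" j] i j x by (simp add: abs_mult D2_def mult_left_mono)
    have "\<bar>D3\<bar> \<le> d i" using osc[of "flip j x" i] i j x by (simp add: D3_def abs_minus_commute)
    then show "\<bar>(Q - Q') * D3\<bar> \<le> R i j * d i"
      unfolding abs_mult Q_def Q'_def
      by (intro mult_mono) (use influence i j x False R_nonneg in auto)
  qed
  finally show ?thesis using False by (simp add: algebra_simps)
qed

text \<open>Resampling site \<open>i\<close> removes \<open>d i\<close> from the total oscillation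
  and returns at most the row sum of influences times \<open>d i\<close>, a net loss of at least
  \<open>\<eta> * d i\<close>. Averaging over the \<open>n\<close> sites gives the factor.\<close>

lemma glauber_contraction:
  assumes osc: "\<And>x j. x \<in> configs n \<Longrightarrow> j < n \<Longrightarrow> \<bar>f x - f (flip j x)\<bar> \<le> d j"
  shows "\<exists>d'. (\<forall>x\<in>configs n. \<forall>j<n. \<bar>glauber f x - glauber f (flip j x)\<bar> \<le> d' j)
    \<and> (\<Sum>j<n. d' j) \<le> (1 - \<eta> / real n) * (\<Sum>j<n. d j)"
proof (intro exI conjI ballI allI impI)
  let ?D = "\<lambda>i j. if i = j then 0 else d j + R i j * d i"
  fix x j assume x: "x \<in> configs n" and j: "j < n"
  have "glauber f x - glauber f (flip j x)
      = (\<Sum>i<n. resample i f x - resample i f (flip j x)) / real n"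
    by (simp add: glauber_def sum_subtractf diff_divide_distrib)
  also have "\<bar>\<dots>\<bar> \<le> (\<Sum>i<n. \<bar>resample i f x - resample i f (flip j x)\<bar>) / real n"
    unfolding abs_divide using sum_abs by (simp add: divide_right_mono)
  also have "\<dots> \<le> (\<Sum>i<n. ?D i j) / real n"
  proof (intro divide_right_mono sum_mono)
    fix i assume "i \<in> {..<n}"
    then show "\<bar>resample i f x - resample i f (flip j x)\<bar> \<le> ?D i j"
      using resample_osc[of f d i j x] osc j x by blast
  qed simp
  finally show "\<bar>glauber f x - glauber f (flip j x)\<bar> \<le> (\<Sum>i<n. ?D i j) / real n" .
next
  let ?D = "\<lambda>i j. if i = j then 0 else d j + R i j * d i"
  have dnn: "0 \<le> d j" if "j < n" for j
    using osc[OF _ that] configs_nonempty[of n] by (metis abs_ge_zero equals0I order_trans)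
  have "(\<Sum>j<n. \<Sum>i<n. ?D i j) = (\<Sum>i<n. \<Sum>j<n. ?D i j)" by (rule sum.swap)
  also have "\<dots> = (\<Sum>i<n. (\<Sum>j<n. d j) - d i + (\<Sum>j\<in>{..<n} - {i}. R i j) * d i)"
  proof (intro sum.cong refl)
    fix i assume "i \<in> {..<n}"
    then have "(\<Sum>j<n. ?D i j) = (\<Sum>j\<in>{..<n} - {i}. d j + R i j * d i)"
      by (subst sum.remove[of _ i]) (auto intro!: sum.cong)
    also have "\<dots> = (\<Sum>j<n. d j) - d i + (\<Sum>j\<in>{..<n} - {i}. R i j) * d i"
      using \<open>i \<in> {..<n}\<close> by (simp add: sum.distrib sum_diff1 left_diff_distrib flip: sum_distrib_right)
    finally show "(\<Sum>j<n. ?D i j) = (\<Sum>j<n. d j) - d i + (\<Sum>j\<in>{..<n} - {i}. R i j) * d i" .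
  qed
  also have "\<dots> \<le> (\<Sum>i<n. (\<Sum>j<n. d j) - d i + (1 - \<eta>) * d i)"
    by (intro sum_mono add_left_mono mult_right_mono row_sum dnn) auto
  also have "\<dots> = (real n - \<eta>) * (\<Sum>j<n. d j)"
    by (simp add: sum.distrib sum_subtractf left_diff_distrib sum_distrib_left)
  finally have "(\<Sum>j<n. \<Sum>i<n. ?D i j) / real n \<le> (real n - \<eta>) * (\<Sum>j<n. d j) / real n"
    by (rule divide_right_mono) simp
  then show "(\<Sum>j<n. (\<Sum>i<n. ?D i j) / real n) \<le> (1 - \<eta> / real n) * (\<Sum>j<n. d j)"
    using n by (simp add: field_simps flip: sum_divide_distrib)
qed

lemma glauber_power_osc:
  "\<exists>D. \<forall>k. \<forall>x\<in>configs n. \<forall>y\<in>configs n.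
     \<bar>(glauber ^^ k) f x - (glauber ^^ k) f y\<bar> \<le> D * (1 - \<eta> / real n) ^ k"
proof -
  have rho: "0 \<le> 1 - \<eta> / real n"
    using n eta_le_1 by (simp add: field_simps)
  define M where "M = Max ((\<lambda>x. \<bar>f x\<bar>) ` configs n)"
  have M: "\<bar>f x\<bar> \<le> M" if "x \<in> configs n" for x
    unfolding M_def by (intro Max_ge) (use that in auto)
  \<comment> \<open>Any initial oscillation bound will do: its size only enters the constant
    \<open>D\<close>, which is eliminated later.\<close>
  define d0 where "d0 = (\<lambda>j::nat. 2 * M)"
  have "\<exists>d. (\<forall>x\<in>configs n. \<forall>j<n. \<bar>(glauber ^^ k) f x - (glauber ^^ k) f (flip j x)\<bar> \<le> d j)
    \<and> (\<Sum>j<n. d j) \<le> (\<Sum>j<n. d0 j) * (1 - \<eta> / real n) ^ k" for k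
  proof (induction k)
    case 0
    show ?case
    proof (intro exI[of _ d0] conjI ballI allI impI)
      fix x j assume "x \<in> configs n" "j < n"
      then show "\<bar>(glauber ^^ 0) f x - (glauber ^^ 0) f (flip j x)\<bar> \<le> d0 j"
        using M[of x] M[of "flip j x"] by (simp add: d0_def)
    qed simp
  next
    case (Suc k)
    then obtain d where d: "\<And>x j. x \<in> configs n \<Longrightarrow> j < n \<Longrightarrow>
          \<bar>(glauber ^^ k) f x - (glauber ^^ k) f (flip j x)\<bar> \<le> d j"
        and sum: "(\<Sum>j<n. d j) \<le> (\<Sum>j<n. d0 j) * (1 - \<eta> / real n) ^ k"
      by blast
    obtain d' where d': "\<forall>x\<in>configs n. \<forall>j<n.
          \<bar>glauber ((glauber ^^ k) f) x - glauber ((glauber ^^ k) f) (flip j x)\<bar> \<le> d' j"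
        and sum': "(\<Sum>j<n. d' j) \<le> (1 - \<eta> / real n) * (\<Sum>j<n. d j)"
      using glauber_contraction[of "(glauber ^^ k) f" d] d by blast
    note sum'
    also have "(1 - \<eta> / real n) * (\<Sum>j<n. d j)
       \<le> (1 - \<eta> / real n) * ((\<Sum>j<n. d0 j) * (1 - \<eta> / real n) ^ k)"
      by (rule mult_left_mono[OF sum rho])
    finally have "(\<Sum>j<n. d' j) \<le> (\<Sum>j<n. d0 j) * (1 - \<eta> / real n) ^ Suc k"
      by (simp add: mult_ac)
    with d' show ?case by auto
  qed
  note osc = this
  show ?thesis
  proof (intro exI[of _ "\<Sum>j<n. d0 j"] allI ballI)
    fix k x y assume xy: "x \<in> configs n" "y \<in> configs n"
    obtain d where d: "\<forall>x\<in>configs n. \<forall>j<n. \<bar>(glauber ^^ k) f x - (glauber ^^ k) f (flip j x)\<bar> \<le> d j"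
        and sum: "(\<Sum>j<n. d j) \<le> (\<Sum>j<n. d0 j) * (1 - \<eta> / real n) ^ k"
      using osc by blast
    show "\<bar>(glauber ^^ k) f x - (glauber ^^ k) f y\<bar> \<le> (\<Sum>j<n. d0 j) * (1 - \<eta> / real n) ^ k"
      using configs_flip_path[of n "(glauber ^^ k) f" d x y] d xy sum by force
  qed
qed

text \<open>
  Iterating the oscillation bound makes \<open>glauber ^^ k\<close> decay at rate \<open>1 - \<eta> / n\<close> on mean-zero
  functions, with a constant depending on \<open>f\<close>; log-convexity of the squared norms removes the constant.
\<close>

lemma glauber_gap:
  assumes mean: "ex f = 0"
  shows "ex (\<lambda>x. (glauber f x)\<^sup>2) \<le> (1 - \<eta> / real n)\<^sup>2 * ex (\<lambda>x. (f x)\<^sup>2)"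
proof -
  define F where "F k = (glauber ^^ k) f" for k
  define b where "b k = ex (\<lambda>x. (F k x)\<^sup>2)" for k
  have F_mean: "ex (F k) = 0" for k
    by (induction k) (simp_all add: F_def mean ex_glauber)
  obtain D where D: "\<And>k x y. x \<in> configs n \<Longrightarrow> y \<in> configs n \<Longrightarrow>
      \<bar>F k x - F k y\<bar> \<le> D * (1 - \<eta> / real n) ^ k"
    using glauber_power_osc[of f] unfolding F_def by blast
  have F_bound: "\<bar>F k x\<bar> \<le> D * (1 - \<eta> / real n) ^ k" if x: "x \<in> configs n" for k x
  proof -
    \<comment> \<open>Mean zero makes \<open>F k x\<close> an average of differences, so the
      oscillation bound becomes a pointwise bound.\<close>
    have 1: "ex (\<lambda>y. F k x - F k y) = F k x" using F_mean by (simp add: ex_diff)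
    have "ex (\<lambda>y. F k x - F k y) \<le> ex (\<lambda>y. D * (1 - \<eta> / real n) ^ k)"
      by (intro ex_mono) (use D[OF x, of _ k] in \<open>auto simp: abs_le_iff\<close>)
    moreover have "ex (\<lambda>y. - (D * (1 - \<eta> / real n) ^ k)) \<le> ex (\<lambda>y. F k x - F k y)"
      by (intro ex_mono) (use D[OF x, of _ k] in \<open>force simp: abs_le_iff\<close>)
    ultimately show ?thesis unfolding 1 by (simp add: abs_le_iff)
  qed
  have "b 1 \<le> (1 - \<eta> / real n)\<^sup>2 * b 0"
  proof (rule log_convex_ratio_le[where D = "D\<^sup>2"])
    show "0 \<le> b k" for k unfolding b_def by (intro ex_nonneg) simp
    show "0 \<le> (1 - \<eta> / real n)\<^sup>2" by simp
    \<comment> \<open>By self-adjointness one factor \<open>glauber\<close> moves across the inner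
      product, so \<open>b (Suc k)\<close> pairs \<open>F k\<close> with
      \<open>F (Suc (Suc k))\<close>; Cauchy-Schwarz finishes.\<close>
    show "(b (Suc k))\<^sup>2 \<le> b k * b (Suc (Suc k))" for k
    proof -
      have "b (Suc k) = ex (\<lambda>x. glauber (F k) x * F (Suc k) x)"
        by (simp add: b_def F_def power2_eq_square)
      also have "\<dots> = ex (\<lambda>x. F k x * F (Suc (Suc k)) x)"
        by (subst glauber_self_adjoint[symmetric]) (simp add: F_def)
      finally show ?thesis using ex_Cauchy_Schwarz by (simp add: b_def)
    qed
    show "b k \<le> D\<^sup>2 * ((1 - \<eta> / real n)\<^sup>2) ^ k" for k
    proof -
      have "b k \<le> ex (\<lambda>x. (D * (1 - \<eta> / real n) ^ k)\<^sup>2)"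
        unfolding b_def by (intro ex_mono) (metis F_bound abs_ge_zero power2_abs power_mono)
      then show ?thesis by (simp add: power_mult_distrib power_mult[symmetric] mult.commute)
    qed
  qed
  then show ?thesis by (simp add: b_def F_def)
qed

text \<open>The gap bounds the inner product of \<open>f\<close> with \<open>f - glauber f\<close>
  below by \<open>\<eta> / real n\<close> times the variance. The Dirichlet form carries the same
  factor \<open>1 / n\<close> from the random choice of a site, so \<open>n\<close> cancels; flip
  probabilities are then bounded by 1.\<close>

lemma poincare:
  assumes mean: "ex f = 0"
  shows "ex (\<lambda>x. (f x)\<^sup>2) \<le> (\<Sum>i<n. ex (\<lambda>x. (f x - f (flip i x))\<^sup>2)) / (2 * \<eta>)"
proof -
  have rho: "0 \<le> 1 - \<eta> / real n"
    using n eta_le_1 by (simp add: field_simps)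
  define V where "V = ex (\<lambda>x. (f x)\<^sup>2)"
  have V: "0 \<le> V" unfolding V_def by (intro ex_nonneg) simp
  have "(ex (\<lambda>x. f x * glauber f x))\<^sup>2 \<le> V * ex (\<lambda>x. (glauber f x)\<^sup>2)"
    unfolding V_def by (rule ex_Cauchy_Schwarz)
  also have "\<dots> \<le> V * ((1 - \<eta> / real n)\<^sup>2 * V)"
    using glauber_gap[OF mean] V by (intro mult_left_mono) (auto simp: V_def)
  also have "\<dots> = ((1 - \<eta> / real n) * V)\<^sup>2" by (simp add: power2_eq_square mult_ac)
  finally have "(ex (\<lambda>x. f x * glauber f x))\<^sup>2 \<le> ((1 - \<eta> / real n) * V)\<^sup>2" .
  then have le: "ex (\<lambda>x. f x * glauber f x) \<le> (1 - \<eta> / real n) * V"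
    by (rule power2_le_imp_le) (use V rho in simp)
  have "\<eta> / real n * V \<le> V - ex (\<lambda>x. f x * glauber f x)"
    using le by (simp add: algebra_simps)
  also have "\<dots> = ex (\<lambda>x. f x * (f x - glauber f x))"
    by (simp add: V_def power2_eq_square right_diff_distrib ex_diff)
  also have "\<dots> = (\<Sum>i<n. ex (\<lambda>x. q i x * (f x - f (flip i x)) * (f x - f (flip i x)))) / (2 * real n)"
    by (rule ex_glauber_diff)
  also have "\<dots> \<le> (\<Sum>i<n. ex (\<lambda>x. (f x - f (flip i x))\<^sup>2)) / (2 * real n)"
  proof (intro divide_right_mono sum_mono ex_mono)
    fix i x assume "i \<in> {..<n}" "x \<in> configs n"
    then have "q i x * (f x - f (flip i x))\<^sup>2 \<le> 1 * (f x - f (flip i x))\<^sup>2"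
      by (intro mult_right_mono q_le_1) auto
    then show "q i x * (f x - f (flip i x)) * (f x - f (flip i x)) \<le> (f x - f (flip i x))\<^sup>2"
      by (simp add: power2_eq_square mult_ac)
  qed simp
  finally have "\<eta> * V \<le> (\<Sum>i<n. ex (\<lambda>x. (f x - f (flip i x))\<^sup>2)) / 2"
    using n by (simp add: field_simps)
  then show ?thesis using eta by (simp add: V_def field_simps)
qed

end

section \<open>Correlations in symmetric Dobrushin measures and Ising models\<close>

abbreviation spin :: "(nat \<Rightarrow> int) \<Rightarrow> nat \<Rightarrow> real" where
  "spin x v \<equiv> real_of_int (x v)"

lemma spin_cases:
  assumes "x \<in> configs n" "v < n"
  shows "spin x v = 1 \<or> spin x v = -1"
proof -
  have "x v \<in> {-1, 1}" using assms by (auto simp: configs_def PiE_iff)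
  then show ?thesis by auto
qed

lemma spin_square [simp]: "x \<in> configs n \<Longrightarrow> v < n \<Longrightarrow> spin x v * spin x v = 1"
  by (drule (1) spin_cases) (elim disjE; simp)

lemma spin_mult_diff_flip:
  "spin x u * spin x v - spin (flip i x) u * spin (flip i x) v
    = (if u = i \<and> v \<noteq> i then 2 * spin x i * spin x v else 0)
      + (if v = i \<and> u \<noteq> i then 2 * spin x i * spin x u else 0)"
  by (simp add: flip_def)

locale symmetric_dobrushin_cube = dobrushin_cube +
  assumes spin_mean: "v < n \<Longrightarrow> ex (\<lambda>x. spin x v) = 0"
begin

definition corr :: "nat \<Rightarrow> nat \<Rightarrow> real" where
  "corr u v = ex (\<lambda>x. spin x u * spin x v)"

lemma corr_commute: "corr u v = corr v u"
  by (simp add: corr_def mult.commute)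

lemma corr_same: "v < n \<Longrightarrow> corr v v = 1"
  using ex_cong[of "\<lambda>x. spin x v * spin x v" "\<lambda>_. 1"] by (simp add: corr_def)

text \<open>A flip at \<open>i\<close> changes the form by \<open>2 * a i * spin x i\<close>, whose
  square is the constant \<open>4 * (a i)\<^sup>2\<close>; dividing by \<open>2 * \<eta>\<close>
  gives the factor.\<close>

lemma linear_second_moment:
  "ex (\<lambda>x. (\<Sum>v<n. a v * spin x v)\<^sup>2) \<le> 2 / \<eta> * (\<Sum>v<n. (a v)\<^sup>2)"
proof -
  let ?f = "\<lambda>x. \<Sum>v<n. a v * spin x v"
  have "ex ?f = 0" by (simp add: ex_sum ex_cmult spin_mean)
  then have "ex (\<lambda>x. (?f x)\<^sup>2) \<le> (\<Sum>i<n. ex (\<lambda>x. (?f x - ?f (flip i x))\<^sup>2)) / (2 * \<eta>)"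
    by (rule poincare)
  also have "(\<Sum>i<n. ex (\<lambda>x. (?f x - ?f (flip i x))\<^sup>2)) = (\<Sum>i<n. 4 * (a i)\<^sup>2)"
  proof (intro sum.cong refl)
    fix i assume i: "i \<in> {..<n}"
    have "(?f x - ?f (flip i x))\<^sup>2 = 4 * (a i)\<^sup>2" if x: "x \<in> configs n" for x
    proof -
      have "?f x - ?f (flip i x) = (\<Sum>v<n. if v = i then 2 * a i * spin x i else 0)"
        unfolding sum_subtractf[symmetric] by (intro sum.cong) (auto simp: flip_def)
      also have "\<dots> = 2 * a i * spin x i" using i by simp
      finally show ?thesis using spin_cases[OF x, of i] i by (auto simp: power2_eq_square)
    qed
    then have "ex (\<lambda>x. (?f x - ?f (flip i x))\<^sup>2) = ex (\<lambda>x. 4 * (a i)\<^sup>2)" by (intro ex_cong)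
    then show "ex (\<lambda>x. (?f x - ?f (flip i x))\<^sup>2) = 4 * (a i)\<^sup>2" by simp
  qed
  finally show ?thesis using eta by (simp add: field_simps flip: sum_distrib_left)
qed

text \<open>A flip at \<open>i\<close> changes the quadratic form by \<open>2 * spin x i\<close>
  times a linear form, to which \<open>linear_second_moment\<close> applies. Centring at
  \<open>corr u v\<close> drops out of the differences and only provides mean zero for
  \<open>poincare\<close>.\<close>

lemma quadratic_variance:
  "ex (\<lambda>x. (\<Sum>u<n. \<Sum>v<n. a u v * (spin x u * spin x v - corr u v))\<^sup>2)
    \<le> 16 / \<eta>\<^sup>2 * (\<Sum>u<n. \<Sum>v<n. (a u v)\<^sup>2)"
proof -
  let ?f = "\<lambda>x. \<Sum>u<n. \<Sum>v<n. a u v * (spin x u * spin x v - corr u v)"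
  have "ex ?f = 0" by (simp add: ex_sum ex_cmult ex_diff corr_def)
  then have "ex (\<lambda>x. (?f x)\<^sup>2) \<le> (\<Sum>i<n. ex (\<lambda>x. (?f x - ?f (flip i x))\<^sup>2)) / (2 * \<eta>)"
    by (rule poincare)
  also have "(\<Sum>i<n. ex (\<lambda>x. (?f x - ?f (flip i x))\<^sup>2))
      \<le> (\<Sum>i<n. 8 / \<eta> * (\<Sum>v<n. 2 * (a i v)\<^sup>2 + 2 * (a v i)\<^sup>2))"
  proof (intro sum_mono)
    fix i assume i: "i \<in> {..<n}"
    \<comment> \<open>Row and column \<open>i\<close> of the coefficients merge. The diagonal entry
      is omitted because the square of a spin does not change under a flip.\<close>
    define c where "c v = (if v = i then 0 else a i v + a v i)" for v
    have "(?f x - ?f (flip i x))\<^sup>2 = 4 * (\<Sum>v<n. c v * spin x v)\<^sup>2" if x: "x \<in> configs n" for x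
    proof -
      let ?g = "\<lambda>u. if u \<noteq> i then a u i * (2 * spin x i * spin x u) else 0"
      let ?h = "\<lambda>v. if v \<noteq> i then a i v * (2 * spin x i * spin x v) else 0"
      have "?f x - ?f (flip i x)
         = (\<Sum>u<n. \<Sum>v<n. a u v * (spin x u * spin x v - spin (flip i x) u * spin (flip i x) v))"
        by (simp add: sum_subtractf algebra_simps)
      also have "\<dots> = (\<Sum>u<n. \<Sum>v<n. (if u = i then ?h v else 0) + (if v = i then ?g u else 0))"
        unfolding spin_mult_diff_flip by (intro sum.cong) auto
      also have "\<dots> = (\<Sum>u<n. \<Sum>v<n. if u = i then ?h v else 0) + (\<Sum>u<n. \<Sum>v<n. if v = i then ?g u else 0)"
        by (simp only: sum.distrib)
      also have "(\<Sum>u<n. \<Sum>v<n. if u = i then ?h v else 0) = (\<Sum>v<n. ?h v)"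
        using i by (subst sum.swap) simp
      also have "(\<Sum>u<n. \<Sum>v<n. if v = i then ?g u else 0) = (\<Sum>u<n. ?g u)"
        using i by simp
      also have "(\<Sum>v<n. ?h v) + (\<Sum>u<n. ?g u) = 2 * spin x i * (\<Sum>v<n. c v * spin x v)"
        unfolding sum.distrib[symmetric] sum_distrib_left
        by (intro sum.cong) (auto simp: c_def algebra_simps)
      finally have "(?f x - ?f (flip i x))\<^sup>2
          = 4 * (spin x i * spin x i) * (\<Sum>v<n. c v * spin x v)\<^sup>2"
        by (simp only: power2_eq_square) (simp add: mult_ac)
      then show ?thesis using x i by simp
    qed
    then have "ex (\<lambda>x. (?f x - ?f (flip i x))\<^sup>2) = ex (\<lambda>x. 4 * (\<Sum>v<n. c v * spin x v)\<^sup>2)"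
      by (intro ex_cong)
    also have "\<dots> \<le> 4 * (2 / \<eta> * (\<Sum>v<n. (c v)\<^sup>2))"
      unfolding ex_cmult by (intro mult_left_mono linear_second_moment) auto
    also have "\<dots> \<le> 4 * (2 / \<eta> * (\<Sum>v<n. 2 * (a i v)\<^sup>2 + 2 * (a v i)\<^sup>2))"
    proof (intro mult_left_mono sum_mono)
      fix v
      show "(c v)\<^sup>2 \<le> 2 * (a i v)\<^sup>2 + 2 * (a v i)\<^sup>2"
        using sum_squares_bound[of "a i v" "a v i"] by (simp add: c_def power2_sum)
    qed (use eta in auto)
    finally show "ex (\<lambda>x. (?f x - ?f (flip i x))\<^sup>2)
        \<le> 8 / \<eta> * (\<Sum>v<n. 2 * (a i v)\<^sup>2 + 2 * (a v i)\<^sup>2)" by simp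
  qed
  also have "(\<Sum>i<n. 8 / \<eta> * (\<Sum>v<n. 2 * (a i v)\<^sup>2 + 2 * (a v i)\<^sup>2))
      = 8 / \<eta> * (2 * (\<Sum>i<n. \<Sum>v<n. (a i v)\<^sup>2) + 2 * (\<Sum>i<n. \<Sum>v<n. (a v i)\<^sup>2))"
    by (simp only: sum.distrib flip: sum_distrib_left)
  also have "(\<Sum>i<n. \<Sum>v<n. (a v i)\<^sup>2) = (\<Sum>i<n. \<Sum>v<n. (a i v)\<^sup>2)" by (rule sum.swap)
  finally have "ex (\<lambda>x. (?f x)\<^sup>2)
    \<le> 8 / \<eta> * (2 * (\<Sum>i<n. \<Sum>v<n. (a i v)\<^sup>2) + 2 * (\<Sum>i<n. \<Sum>v<n. (a i v)\<^sup>2)) / (2 * \<eta>)"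
    using eta by (simp add: divide_right_mono)
  moreover have "8 / \<eta> * (2 * A + 2 * A) / (2 * \<eta>) = 16 / \<eta>\<^sup>2 * A" for A
    using eta by (simp add: power2_eq_square)
  ultimately show ?thesis by (simp only:)
qed

text \<open>The sum \<open>S\<close> is itself the correlation of spin \<open>u\<close> with the
  linear form whose coefficients are the row. Cauchy-Schwarz and the linear bound give
  \<open>S * S \<le> 2 / \<eta> * S\<close>.\<close>

lemma corr_row_sum:
  assumes u: "u < n"
  shows "(\<Sum>v<n. (corr u v)\<^sup>2) \<le> 2 / \<eta>"
proof -
  define S where "S = (\<Sum>v<n. (corr u v)\<^sup>2)"
  have S: "0 \<le> S" unfolding S_def by (intro sum_nonneg) simp
  have "S = ex (\<lambda>x. spin x u * (\<Sum>v<n. corr u v * spin x v))"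
  proof -
    have "ex (\<lambda>x. spin x u * (\<Sum>v<n. corr u v * spin x v))
       = ex (\<lambda>x. (\<Sum>v<n. corr u v * (spin x u * spin x v)))"
      by (simp add: sum_distrib_left mult_ac)
    then show ?thesis by (simp add: ex_sum ex_cmult S_def power2_eq_square flip: corr_def)
  qed
  then have "S\<^sup>2 \<le> ex (\<lambda>x. (spin x u)\<^sup>2) * ex (\<lambda>x. (\<Sum>v<n. corr u v * spin x v)\<^sup>2)"
    using ex_Cauchy_Schwarz by simp
  also have "ex (\<lambda>x. (spin x u)\<^sup>2) = 1"
    using corr_same[OF u] by (simp add: corr_def power2_eq_square)
  also have "ex (\<lambda>x. (\<Sum>v<n. corr u v * spin x v)\<^sup>2) \<le> 2 / \<eta> * S"
    unfolding S_def by (rule linear_second_moment)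
  finally have "S * S \<le> 2 / \<eta> * S" by (simp add: power2_eq_square)
  then have "S \<le> 2 / \<eta>"
  proof (cases "S = 0")
    case False
    with S have "0 < S" by simp
    with \<open>S * S \<le> 2 / \<eta> * S\<close> show ?thesis by (rule mult_right_le_imp_le)
  qed (use eta in simp)
  then show ?thesis by (simp add: S_def)
qed

end

section \<open>The Ising model without external field as a symmetric Dobrushin measure\<close>

lemma sum_offdiag:
  fixes g :: "nat \<Rightarrow> nat \<Rightarrow> real"
  assumes "\<And>u v. u < n \<Longrightarrow> v < n \<Longrightarrow> g u v = g v u"
  shows "(\<Sum>v<n. \<Sum>u<n. if u = v then 0 else g u v) = 2 * (\<Sum>v<n. \<Sum>u<v. g u v)"
  using assms
proof (induction n)
  case (Suc n)
  have "(\<Sum>v<Suc n. \<Sum>u<Suc n. if u = v then 0 else g u v)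
    = (\<Sum>v<n. (\<Sum>u<n. if u = v then 0 else g u v)) + (\<Sum>v<n. g n v) + (\<Sum>u<n. g u n)"
    by (simp add: sum.distrib)
  also have "(\<Sum>v<n. g n v) = (\<Sum>u<n. g u n)"
    by (intro sum.cong refl Suc.prems) auto
  finally show ?case using Suc by simp
qed simp

text \<open>The flip probability is logistic in the local field, and a neighbouring spin moves the
  field between \<open>c + t\<close> and \<open>c - t\<close>. The effect is largest at
  \<open>c = 0\<close>, where it equals \<open>tanh \<bar>t\<bar>\<close>.\<close>

lemma logistic_diff_le_tanh:
  fixes c t :: real
  shows "\<bar>1 / (1 + exp (2 * (c + t))) - 1 / (1 + exp (2 * (c - t)))\<bar> \<le> tanh \<bar>t\<bar>"
proof -
  have *: "\<bar>1 / (1 + exp (2 * (c + t))) - 1 / (1 + exp (2 * (c - t)))\<bar> \<le> tanh t" if t: "0 \<le> t" for t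
  proof -
    define E where "E = exp (2 * c)"
    define y where "y = exp (2 * t)"
    have pos: "E > 0" "y \<ge> 1" using t by (auto simp: E_def y_def)
    \<comment> \<open>The slack \<open>y * (1 - E)\<^sup>2\<close> vanishes at \<open>E = 1\<close>,
      that is, for zero background field.\<close>
    have sq: "E * (y + 1)\<^sup>2 \<le> (y + E) * (1 + E * y)"
    proof -
      have "(y + E) * (1 + E * y) - E * (y + 1)\<^sup>2 = y * (1 - E)\<^sup>2"
        by (simp add: power2_eq_square algebra_simps)
      then show ?thesis using pos by (smt (verit) mult_nonneg_nonneg zero_le_power2)
    qed
    have e1: "exp (2 * (c + t)) = E * y" by (simp add: E_def y_def ring_distribs exp_add)
    have e2: "exp (2 * (c - t)) = E / y" by (simp add: E_def y_def right_diff_distrib exp_diff)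
    have ne: "1 + E * y \<noteq> 0" "y + E \<noteq> 0" "y \<noteq> 0" using pos by (smt (verit) mult_pos_pos)+
    have "1 / (1 + E / y) - 1 / (1 + E * y) = y / (y + E) - 1 / (1 + E * y)"
      using pos by (simp add: field_simps)
    also have "\<dots> = E * (y\<^sup>2 - 1) / ((y + E) * (1 + E * y))"
      using ne by (simp add: field_simps power2_eq_square)
    finally have eq: "1 / (1 + E / y) - 1 / (1 + E * y) = E * (y\<^sup>2 - 1) / ((y + E) * (1 + E * y))" .
    have "0 \<le> E * (y\<^sup>2 - 1)" using pos by simp
    then have nonneg: "0 \<le> E * (y\<^sup>2 - 1) / ((y + E) * (1 + E * y))" using pos by simp
    have "E * (y\<^sup>2 - 1) / ((y + E) * (1 + E * y)) \<le> E * (y\<^sup>2 - 1) / (E * (y + 1)\<^sup>2)"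
      using sq pos \<open>0 \<le> E * (y\<^sup>2 - 1)\<close>
      by (intro divide_left_mono mult_pos_pos) (auto simp: add_pos_pos)
    also have "\<dots> = (y - 1) / (y + 1)"
    proof -
      have "y\<^sup>2 - 1 = (y - 1) * (y + 1)" by (simp add: power2_eq_square algebra_simps)
      then show ?thesis using pos by (simp add: power2_eq_square)
    qed
    also have "\<dots> = tanh t"
    proof -
      have "exp (- 2 * t) = 1 / y" by (simp add: y_def exp_minus field_simps)
      then have "tanh t = (1 - 1 / y) / (1 + 1 / y)" by (simp add: tanh_real_altdef)
      also have "\<dots> = (y - 1) / (y + 1)" using pos by (simp add: divide_simps)
      finally show ?thesis ..
    qed
    finally have "E * (y\<^sup>2 - 1) / ((y + E) * (1 + E * y)) \<le> tanh t" .
    then show ?thesis using nonneg unfolding e1 e2 eq[symmetric] by linarith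
  qed
  show ?thesis
  proof (cases "0 \<le> t")
    case False
    then show ?thesis using *[of "- t"] by (simp add: abs_minus_commute)
  qed (use * in simp)
qed

definition interaction :: "nat \<Rightarrow> (nat \<Rightarrow> nat \<Rightarrow> real) \<Rightarrow> (nat \<Rightarrow> int) \<Rightarrow> real" where
  "interaction n \<theta> x = (\<Sum>v<n. \<Sum>u<v. \<theta> u v * spin x u * spin x v)"

lemma ising_weight_no_field: "ising_weight n (\<lambda>_. 0) \<theta> x = exp (interaction n \<theta> x)"
  by (simp add: ising_weight_def interaction_def)

lemma interaction_flip:
  assumes sym: "\<And>u v. u < n \<Longrightarrow> v < n \<Longrightarrow> \<theta> u v = \<theta> v u" and i: "i < n"
  shows "interaction n \<theta> (flip i x)
    = interaction n \<theta> x - 2 * spin x i * (\<Sum>u\<in>{..<n} - {i}. \<theta> i u * spin x u)"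
proof -
  let ?h = "\<lambda>u. if u = i then 0 else \<theta> i u * (2 * spin x i * spin x u)"
  have twice: "2 * interaction n \<theta> y = (\<Sum>v<n. \<Sum>u<n. if u = v then 0 else \<theta> u v * spin y u * spin y v)" for y
    unfolding interaction_def by (rule sum_offdiag[symmetric]) (simp add: sym)
  have "2 * (interaction n \<theta> x - interaction n \<theta> (flip i x))
    = (\<Sum>v<n. \<Sum>u<n. if u = v then 0 else
         \<theta> u v * (spin x u * spin x v - spin (flip i x) u * spin (flip i x) v))"
    unfolding right_diff_distrib twice sum_subtractf[symmetric]
    by (intro sum.cong) (auto simp: algebra_simps)
  also have "\<dots> = (\<Sum>v<n. \<Sum>u<n. (if u = i then ?h v else 0) + (if v = i then ?h u else 0))"
    unfolding spin_mult_diff_flip by (intro sum.cong) (auto simp: sym i)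
  also have "\<dots> = (\<Sum>v<n. \<Sum>u<n. if u = i then ?h v else 0) + (\<Sum>v<n. \<Sum>u<n. if v = i then ?h u else 0)"
    by (simp only: sum.distrib)
  also have "(\<Sum>v<n. \<Sum>u<n. if u = i then ?h v else 0) = (\<Sum>v<n. ?h v)"
    using i by simp
  also have "(\<Sum>v<n. \<Sum>u<n. if v = i then ?h u else 0) = (\<Sum>v<n. ?h v)"
    using i by (subst sum.swap) simp
  also have "(\<Sum>v<n. ?h v) = 2 * spin x i * (\<Sum>u\<in>{..<n} - {i}. \<theta> i u * spin x u)"
    using i by (subst sum.remove[of _ i]) (auto simp: sum_distrib_left mult_ac intro!: sum.cong)
  finally show ?thesis by simp
qed

lemma ising_pos: "x \<in> configs n \<Longrightarrow> 0 < pmf (ising n h \<theta>) x"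
  by (auto simp: pmf_ising ising_weight_def intro!: divide_pos_pos sum_pos)

lemma set_pmf_ising: "set_pmf (ising n h \<theta>) = configs n"
proof (intro set_eqI iffI)
  show "x \<in> configs n" if "x \<in> set_pmf (ising n h \<theta>)" for x
    using that by (auto simp: set_pmf_iff pmf_ising split: if_splits)
  show "x \<in> set_pmf (ising n h \<theta>)" if "x \<in> configs n" for x
    using ising_pos[OF that, of h \<theta>] by (auto simp: set_pmf_iff)
qed

lemma ising_ratio:
  fixes \<theta> :: "nat \<Rightarrow> nat \<Rightarrow> real"
  assumes x: "x \<in> configs n" and y: "y \<in> configs n"
  defines "w \<equiv> pmf (ising n (\<lambda>_. 0) \<theta>)"
  shows "w y / (w x + w y) = 1 / (1 + exp (interaction n \<theta> x - interaction n \<theta> y))"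
proof -
  define Z where "Z = (\<Sum>y\<in>configs n. ising_weight n (\<lambda>_. 0) \<theta> y)"
  have Z: "Z > 0" unfolding Z_def by (intro sum_pos) (auto simp: ising_weight_def)
  have w: "w x = exp (interaction n \<theta> x) / Z" "w y = exp (interaction n \<theta> y) / Z"
    using x y by (simp_all add: w_def pmf_ising Z_def ising_weight_no_field)
  have "w x = w y * exp (interaction n \<theta> x - interaction n \<theta> y)"
    by (simp add: w exp_diff)
  moreover have "w y > 0" by (simp add: w Z)
  ultimately have "w x + w y = w y * (1 + exp (interaction n \<theta> x - interaction n \<theta> y))"
    by (simp add: algebra_simps)
  then show ?thesis using \<open>w y > 0\<close> by (simp only:) simp
qed

text \<open>Influences come from the logistic form of the conditional law at a site. The vanishing
  means come from global spin reversal, which preserves every pair interaction.\<close>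

lemma ising_symmetric_dobrushin:
  fixes \<theta> :: "nat \<Rightarrow> nat \<Rightarrow> real"
  assumes n: "n \<ge> 1" and eta: "\<eta> > 0"
    and sym: "\<And>u v. u < n \<Longrightarrow> v < n \<Longrightarrow> \<theta> u v = \<theta> v u"
    and ht: "high_temperature n \<eta> \<theta>"
  defines "w \<equiv> pmf (ising n (\<lambda>_. 0) \<theta>)"
  shows "symmetric_dobrushin_cube n w (\<lambda>i j. tanh \<bar>\<theta> i j\<bar>)
    (\<lambda>i x. w (flip i x) / (w x + w (flip i x))) \<eta>"
proof -
  let ?h = "\<lambda>x i. \<Sum>u\<in>{..<n} - {i}. \<theta> i u * spin x u"
  have q: "w (flip i x) / (w x + w (flip i x)) = 1 / (1 + exp (2 * (spin x i * ?h x i)))"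
    if "i < n" "x \<in> configs n" for i x
    using ising_ratio[of x n "flip i x" \<theta>] that interaction_flip[of n \<theta> i x, OF sym]
    by (simp add: w_def mult.assoc)
  interpret dobrushin_cube n w "\<lambda>i j. tanh \<bar>\<theta> i j\<bar>"
    "\<lambda>i x. w (flip i x) / (w x + w (flip i x))" \<eta>
  proof
    show "0 < n" "0 < \<eta>" using n eta by auto
    show "0 < w x" if "x \<in> configs n" for x using that by (simp add: w_def ising_pos)
    show "(\<Sum>x\<in>configs n. w x) = 1"
      unfolding w_def by (intro sum_pmf_eq_1) (auto simp: set_pmf_ising)
  next
    fix i j x assume ij: "i < n" "j < n" "i \<noteq> j" and x: "x \<in> configs n"
    have "?h x i = \<theta> i j * spin x j + (\<Sum>u\<in>{..<n} - {i} - {j}. \<theta> i u * spin x u)"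
      using ij by (intro sum.remove) auto
    moreover have "?h (flip j x) i = - \<theta> i j * spin x j + (\<Sum>u\<in>{..<n} - {i} - {j}. \<theta> i u * spin x u)"
      using ij by (subst sum.remove[of _ j]) (auto simp: flip_def)
    ultimately have h: "?h (flip j x) i = ?h x i - 2 * (\<theta> i j * spin x j)" by simp
    \<comment> \<open>The contribution of spin \<open>j\<close> is separated from the rest
      \<open>c\<close> of the local field, so that a flip at \<open>j\<close> exchanges
      \<open>c + t\<close> and \<open>c - t\<close>.\<close>
    define t where "t = spin x i * \<theta> i j * spin x j"
    define c where "c = spin x i * ?h x i - t"
    have 1: "spin x i * ?h x i = c + t" by (simp add: c_def)
    have 2: "spin (flip j x) i * ?h (flip j x) i = c - t"
      unfolding h using ij by (simp add: c_def t_def flip_def algebra_simps)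
    have t: "\<bar>t\<bar> = \<bar>\<theta> i j\<bar>"
      using spin_cases[OF x, of i] spin_cases[OF x, of j] ij by (auto simp: t_def abs_mult)
    show "\<bar>w (flip i x) / (w x + w (flip i x))
        - w (flip i (flip j x)) / (w (flip j x) + w (flip i (flip j x)))\<bar> \<le> tanh \<bar>\<theta> i j\<bar>"
      using logistic_diff_le_tanh[of c t] ij x by (simp only: q flip_in_configs 1 2 t)
  next
    fix i assume i: "i < n"
    have "(\<Sum>u\<in>{..<n} - {i}. tanh \<bar>\<theta> u i\<bar>) \<le> (MAX v\<in>{..<n}. \<Sum>u\<in>{..<n} - {v}. tanh \<bar>\<theta> u v\<bar>)"
      by (intro Max_ge) (use i in auto)
    then have "(\<Sum>u\<in>{..<n} - {i}. tanh \<bar>\<theta> u i\<bar>) \<le> 1 - \<eta>"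
      using ht by (simp add: high_temperature_def)
    \<comment> \<open>\<open>high_temperature\<close> bounds column sums, the locale asks for row
      sums; symmetry of \<theta> reconciles them.\<close>
    moreover have "(\<Sum>u\<in>{..<n} - {i}. tanh \<bar>\<theta> u i\<bar>) = (\<Sum>u\<in>{..<n} - {i}. tanh \<bar>\<theta> i u\<bar>)"
      using i sym by (intro sum.cong) auto
    ultimately show "(\<Sum>j\<in>{..<n} - {i}. tanh \<bar>\<theta> i j\<bar>) \<le> 1 - \<eta>" by simp
  qed simp_all
  show ?thesis
  proof
    fix v assume v: "v < n"
    \<comment> \<open>Reversal must keep the value \<open>undefined\<close> outside the vertex set,
      since configurations are extensional.\<close>
    define neg where "neg x = (\<lambda>u. if u < n then - x u else undefined)" for x :: "nat \<Rightarrow> int"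
    have neg: "neg x \<in> configs n" "neg (neg x) = x" if "x \<in> configs n" for x
      using that by (auto simp: neg_def configs_def PiE_iff extensional_def fun_eq_iff)
    have w_neg: "w (neg x) = w x" if "x \<in> configs n" for x
    proof -
      have "interaction n \<theta> (neg x) = interaction n \<theta> x"
        unfolding interaction_def by (intro sum.cong) (auto simp: neg_def)
      then show ?thesis using that neg by (simp add: w_def pmf_ising ising_weight_no_field)
    qed
    have "ex (\<lambda>x. spin x v) = (\<Sum>x\<in>configs n. w (neg x) * spin (neg x) v)"
      unfolding ex_def by (rule sum.reindex_bij_witness[of _ neg neg]) (use neg in auto)
    also have "\<dots> = - ex (\<lambda>x. spin x v)"
      unfolding ex_def sum_negf[symmetric] by (intro sum.cong) (use v in \<open>auto simp: w_neg\<close>, simp add: neg_def)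
    finally show "ex (\<lambda>x. spin x v) = 0" by simp
  qed
qed

section \<open>Second moments of U-statistics\<close>

lemma finite_replicate_pmf [simp]:
  "finite (set_pmf p) \<Longrightarrow> finite (set_pmf (replicate_pmf m p))"
proof -
  assume "finite (set_pmf p)"
  then have "finite {xs. set xs \<subseteq> set_pmf p \<and> length xs = m}"
    by (rule finite_lists_length_eq)
  then show ?thesis
    by (rule rev_finite_subset) (auto simp: set_replicate_pmf)
qed

lemma integrable_pmf_finite [simp]:
  fixes f :: "'a \<Rightarrow> real"
  shows "finite (set_pmf p) \<Longrightarrow> integrable (measure_pmf p) f"
  by (rule integrable_measure_pmf_finite)

lemma expectation_mono_pmf:
  fixes f g :: "'a \<Rightarrow> real"
  assumes "finite (set_pmf p)" "\<And>x. x \<in> set_pmf p \<Longrightarrow> f x \<le> g x"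
  shows "measure_pmf.expectation p f \<le> measure_pmf.expectation p g"
  by (rule integral_mono_AE) (use assms in \<open>auto simp: AE_measure_pmf_iff\<close>)

lemma expectation_cong_pmf:
  fixes f g :: "'a \<Rightarrow> real"
  assumes "\<And>x. x \<in> set_pmf p \<Longrightarrow> f x = g x"
  shows "measure_pmf.expectation p f = measure_pmf.expectation p g"
  by (rule integral_cong_AE) (use assms in \<open>auto simp: AE_measure_pmf_iff\<close>)

lemma expectation_swap:
  fixes f :: "'a \<Rightarrow> 'b \<Rightarrow> real"
  assumes "finite (set_pmf p)" "finite (set_pmf q)"
  shows "measure_pmf.expectation p (\<lambda>x. measure_pmf.expectation q (f x))
    = measure_pmf.expectation q (\<lambda>y. measure_pmf.expectation p (\<lambda>x. f x y))"
proof -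
  have p: "measure_pmf.expectation p g = (\<Sum>x\<in>set_pmf p. g x * pmf p x)" for g :: "'a \<Rightarrow> real"
    by (rule integral_measure_pmf_real) (use assms in auto)
  have q: "measure_pmf.expectation q g = (\<Sum>x\<in>set_pmf q. g x * pmf q x)" for g :: "'b \<Rightarrow> real"
    by (rule integral_measure_pmf_real) (use assms in auto)
  show ?thesis
    unfolding p q sum_distrib_right by (subst sum.swap) (simp add: mult_ac)
qed

lemma expectation_replicate_Suc:
  fixes F :: "'a list \<Rightarrow> real"
  assumes "finite (set_pmf p)"
  shows "measure_pmf.expectation (replicate_pmf (Suc m) p) F
    = measure_pmf.expectation p (\<lambda>x. measure_pmf.expectation (replicate_pmf m p) (\<lambda>xs. F (x # xs)))"
proof -
  have "replicate_pmf (Suc m) p = p \<bind> (\<lambda>x. map_pmf ((#) x) (replicate_pmf m p))"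
    by (simp add: map_pmf_def)
  also have "measure_pmf.expectation \<dots> F
    = (\<Sum>x\<in>set_pmf p. pmf p x *\<^sub>R measure_pmf.expectation (map_pmf ((#) x) (replicate_pmf m p)) F)"
    by (rule pmf_expectation_bind) (use assms in auto)
  also have "\<dots> = measure_pmf.expectation p (\<lambda>x. measure_pmf.expectation (replicate_pmf m p) (\<lambda>xs. F (x # xs)))"
    by (simp add: integral_measure_pmf_real[OF assms] mult.commute)
  finally show ?thesis .
qed

text \<open>The value type is general so that one definition serves both the integer statistic and
  the real kernels of the variance analysis.\<close>

definition pair_sum :: "('a \<Rightarrow> 'a \<Rightarrow> 'b::comm_monoid_add) \<Rightarrow> 'a list \<Rightarrow> 'b" where
  "pair_sum h xs = (\<Sum>i<length xs. \<Sum>j<i. h (xs ! i) (xs ! j))"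

lemma pair_sum_Nil [simp]: "pair_sum h [] = 0"
  by (simp add: pair_sum_def)

text \<open>The head has the smallest index, so it is the second argument in all its pairs. This
  recursion drives the inductions over the samples.\<close>

lemma pair_sum_Cons [simp]: "pair_sum h (x # xs) = pair_sum h xs + (\<Sum>y\<leftarrow>xs. h y x)"
proof -
  have "pair_sum h (x # xs) = (\<Sum>i<length xs. \<Sum>j<Suc i. h (xs ! i) ((x # xs) ! j))"
    unfolding pair_sum_def length_Cons sum.lessThan_Suc_shift by simp
  also have "\<dots> = (\<Sum>i<length xs. h (xs ! i) x + (\<Sum>j<i. h (xs ! i) (xs ! j)))"
    by (simp add: sum.lessThan_Suc_shift del: sum.lessThan_Suc)
  finally show ?thesis
    by (simp add: sum.distrib pair_sum_def sum_list_sum_nth atLeast0LessThan add.commute)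
qed

lemma expectation_sum_list:
  fixes g :: "'a \<Rightarrow> real"
  assumes fin: "finite (set_pmf p)" and mean: "measure_pmf.expectation p g = 0"
  shows "measure_pmf.expectation (replicate_pmf m p) (\<lambda>xs. \<Sum>y\<leftarrow>xs. g y) = 0"
    and "measure_pmf.expectation (replicate_pmf m p) (\<lambda>xs. (\<Sum>y\<leftarrow>xs. g y)\<^sup>2)
      = real m * measure_pmf.expectation p (\<lambda>x. (g x)\<^sup>2)"
proof (induction m)
  case (Suc m)
  {
    case 1
    then show ?case using fin mean Suc.IH
      unfolding expectation_replicate_Suc[OF fin] by simp
  next
    case 2
    have "measure_pmf.expectation (replicate_pmf m p) (\<lambda>xs. (\<Sum>y\<leftarrow>x # xs. g y)\<^sup>2)
       = (g x)\<^sup>2 + real m * measure_pmf.expectation p (\<lambda>x. (g x)\<^sup>2)" for x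
      using fin Suc.IH by (simp add: power2_sum mult.assoc)
    then show ?case using fin
      unfolding expectation_replicate_Suc[OF fin] by (simp add: algebra_simps del: sum_list.Cons list.map)
  }
qed simp_all

text \<open>Degeneracy in each argument makes distinct pairs orthogonal, so the second moments of
  the pairs add up. In the induction the fresh sample is the second argument: \<open>mean2\<close>
  removes the cross term with the old pairs, and \<open>mean1\<close> makes the new pairs orthogonal
  to each other.\<close>

lemma expectation_pair_sum_square:
  fixes r :: "'a \<Rightarrow> 'a \<Rightarrow> real"
  assumes fin: "finite (set_pmf p)"
    and mean1: "\<And>y. y \<in> set_pmf p \<Longrightarrow> measure_pmf.expectation p (\<lambda>x. r x y) = 0"
    and mean2: "\<And>x. x \<in> set_pmf p \<Longrightarrow> measure_pmf.expectation p (\<lambda>y. r x y) = 0"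
  shows "measure_pmf.expectation (replicate_pmf m p) (\<lambda>xs. (pair_sum r xs)\<^sup>2)
    = real m * (real m - 1) / 2
      * measure_pmf.expectation p (\<lambda>x. measure_pmf.expectation p (\<lambda>y. (r y x)\<^sup>2))"
proof (induction m)
  case (Suc m)
  let ?E = "measure_pmf.expectation (replicate_pmf m p)"
  let ?V = "measure_pmf.expectation p (\<lambda>x. measure_pmf.expectation p (\<lambda>y. (r y x)\<^sup>2))"
  have row: "?E (\<lambda>xs. (\<Sum>y\<leftarrow>xs. r y x)\<^sup>2) = real m * measure_pmf.expectation p (\<lambda>y. (r y x)\<^sup>2)"
    if "x \<in> set_pmf p" for x
    by (rule expectation_sum_list(2)[OF fin mean1[OF that]])
  have "measure_pmf.expectation p (\<lambda>x. ?E (\<lambda>xs. pair_sum r xs * (\<Sum>y\<leftarrow>xs. r y x)))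
    = ?E (\<lambda>xs. measure_pmf.expectation p (\<lambda>x. pair_sum r xs * (\<Sum>y\<leftarrow>xs. r y x)))"
    using fin by (intro expectation_swap) auto
  also have "\<dots> = ?E (\<lambda>xs. 0)"
  proof (rule expectation_cong_pmf)
    fix xs assume "xs \<in> set_pmf (replicate_pmf m p)"
    then have "set xs \<subseteq> set_pmf p" by (auto simp: set_replicate_pmf)
    then have "measure_pmf.expectation p (\<lambda>x. \<Sum>y\<leftarrow>xs. r y x) = 0"
      using fin by (induction xs) (auto simp: mean2)
    then show "measure_pmf.expectation p (\<lambda>x. pair_sum r xs * (\<Sum>y\<leftarrow>xs. r y x)) = 0" by simp
  qed
  finally have cross: "measure_pmf.expectation p (\<lambda>x. ?E (\<lambda>xs. pair_sum r xs * (\<Sum>y\<leftarrow>xs. r y x))) = 0"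
    by simp
  have "measure_pmf.expectation (replicate_pmf (Suc m) p) (\<lambda>xs. (pair_sum r xs)\<^sup>2)
    = measure_pmf.expectation p (\<lambda>x. ?E (\<lambda>xs. (pair_sum r xs)\<^sup>2)
        + 2 * ?E (\<lambda>xs. pair_sum r xs * (\<Sum>y\<leftarrow>xs. r y x))
        + real m * measure_pmf.expectation p (\<lambda>y. (r y x)\<^sup>2))"
    unfolding expectation_replicate_Suc[OF fin]
    by (rule expectation_cong_pmf) (use fin row in \<open>simp add: power2_sum mult.assoc\<close>)
  also have "\<dots> = ?E (\<lambda>xs. (pair_sum r xs)\<^sup>2) + real m * ?V"
    using fin cross by simp
  also have "\<dots> = real (Suc m) * (real (Suc m) - 1) / 2 * ?V"
    by (simp add: Suc.IH field_simps)
  finally show ?case .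
qed simp

lemma prob_le_second_moment:
  fixes Z :: "'a \<Rightarrow> real"
  assumes fin: "finite (set_pmf p)" and a: "0 < a"
    and A: "\<And>x. x \<in> set_pmf p \<Longrightarrow> x \<in> A \<Longrightarrow> a \<le> \<bar>Z x\<bar>"
  shows "measure_pmf.prob p A \<le> measure_pmf.expectation p (\<lambda>x. (Z x)\<^sup>2) / a\<^sup>2"
proof -
  have "a\<^sup>2 * measure_pmf.prob p A = measure_pmf.expectation p (\<lambda>x. a\<^sup>2 * indicator A x)"
    by simp
  also have "\<dots> \<le> measure_pmf.expectation p (\<lambda>x. (Z x)\<^sup>2)"
  proof (rule expectation_mono_pmf[OF fin])
    fix x assume "x \<in> set_pmf p"
    then show "a\<^sup>2 * indicator A x \<le> (Z x)\<^sup>2"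
      using A[of x] a power_mono[of a "\<bar>Z x\<bar>" 2] by (auto simp: indicator_def)
  qed
  finally show ?thesis using a by (simp add: field_simps)
qed

text \<open>The hypothesis on \<open>h\<close> is the Hoeffding decomposition of the kernel.\<close>

lemma pair_sum_concentration:
  fixes h r :: "'a \<Rightarrow> 'a \<Rightarrow> real" and g :: "'a \<Rightarrow> real"
  assumes fin: "finite (set_pmf p)" and a: "0 < a"
    and h: "\<And>x y. x \<in> set_pmf p \<Longrightarrow> y \<in> set_pmf p \<Longrightarrow> h x y = \<mu> + g x + g y + r x y"
    and g_mean: "measure_pmf.expectation p g = 0"
    and mean1: "\<And>y. y \<in> set_pmf p \<Longrightarrow> measure_pmf.expectation p (\<lambda>x. r x y) = 0"
    and mean2: "\<And>x. x \<in> set_pmf p \<Longrightarrow> measure_pmf.expectation p (\<lambda>y. r x y) = 0"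
    and Vg: "measure_pmf.expectation p (\<lambda>x. (g x)\<^sup>2) \<le> Vg"
    and Vr: "\<And>x. x \<in> set_pmf p \<Longrightarrow> measure_pmf.expectation p (\<lambda>y. (r y x)\<^sup>2) \<le> Vr"
    and A: "\<And>xs. xs \<in> A \<Longrightarrow> length xs = m \<Longrightarrow> set xs \<subseteq> set_pmf p \<Longrightarrow>
       a \<le> \<bar>pair_sum h xs - real m * (real m - 1) / 2 * \<mu>\<bar>"
  shows "measure_pmf.prob (replicate_pmf m p) A
    \<le> (2 * real m * (real m - 1)\<^sup>2 * Vg + real m * (real m - 1) * Vr) / a\<^sup>2"
proof -
  let ?P = "replicate_pmf m p"
  let ?Z = "\<lambda>xs. pair_sum h xs - real m * (real m - 1) / 2 * \<mu>"
  have supp: "set xs \<subseteq> set_pmf p" "length xs = m" if "xs \<in> set_pmf ?P" for xs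
    using that by (auto simp: set_replicate_pmf)
  \<comment> \<open>Each sample takes part in \<open>length xs - 1\<close> pairs, which is the
    multiplicity of the linear part.\<close>
  have decomp: "pair_sum h xs = real (length xs) * (real (length xs) - 1) / 2 * \<mu>
      + (real (length xs) - 1) * (\<Sum>y\<leftarrow>xs. g y) + pair_sum r xs"
    if "set xs \<subseteq> set_pmf p" for xs
    using that
  proof (induction xs)
    case (Cons x xs)
    have "(\<Sum>y\<leftarrow>xs. h y x) = (\<Sum>y\<leftarrow>xs. \<mu> + g y + g x + r y x)"
      by (intro arg_cong[where f = sum_list] map_cong refl h) (use Cons.prems in auto)
    also have "\<dots> = real (length xs) * \<mu> + (\<Sum>y\<leftarrow>xs. g y) + real (length xs) * g x + (\<Sum>y\<leftarrow>xs. r y x)"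
      by (induction xs) (simp_all add: algebra_simps)
    finally show ?case using Cons by (simp add: field_simps)
  qed simp
  have "measure_pmf.prob ?P A \<le> measure_pmf.expectation ?P (\<lambda>xs. (?Z xs)\<^sup>2) / a\<^sup>2"
    by (rule prob_le_second_moment) (use fin a A supp in auto)
  also have "measure_pmf.expectation ?P (\<lambda>xs. (?Z xs)\<^sup>2)
    \<le> measure_pmf.expectation ?P (\<lambda>xs. 2 * (real m - 1)\<^sup>2 * (\<Sum>y\<leftarrow>xs. g y)\<^sup>2 + 2 * (pair_sum r xs)\<^sup>2)"
  proof (rule expectation_mono_pmf)
    fix xs assume "xs \<in> set_pmf ?P"
    then have Z: "?Z xs = (real m - 1) * (\<Sum>y\<leftarrow>xs. g y) + pair_sum r xs"
      using decomp[of xs] supp[of xs] by simp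
    show "(?Z xs)\<^sup>2 \<le> 2 * (real m - 1)\<^sup>2 * (\<Sum>y\<leftarrow>xs. g y)\<^sup>2 + 2 * (pair_sum r xs)\<^sup>2"
      using sum_squares_bound[of "(real m - 1) * (\<Sum>y\<leftarrow>xs. g y)" "pair_sum r xs"]
      unfolding Z power2_sum by (simp add: power_mult_distrib)
  qed (use fin in simp)
  also have "\<dots> = 2 * (real m - 1)\<^sup>2 * (real m * measure_pmf.expectation p (\<lambda>x. (g x)\<^sup>2))
      + real m * (real m - 1) * measure_pmf.expectation p (\<lambda>x. measure_pmf.expectation p (\<lambda>y. (r y x)\<^sup>2))"
    using fin by (simp add: expectation_sum_list(2)[OF fin g_mean]
        expectation_pair_sum_square[of p r, OF fin mean1 mean2])
  also have "\<dots> \<le> 2 * (real m - 1)\<^sup>2 * (real m * Vg) + real m * (real m - 1) * Vr"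
  proof -
    have mm: "0 \<le> real m * (real m - 1)" by (cases m) auto
    have "measure_pmf.expectation p (\<lambda>x. measure_pmf.expectation p (\<lambda>y. (r y x)\<^sup>2))
      \<le> measure_pmf.expectation p (\<lambda>x. Vr)"
      by (rule expectation_mono_pmf[OF fin Vr])
    then show ?thesis
      by (intro add_mono mult_left_mono Vg mm) auto
  qed
  finally show ?thesis using a by (simp add: divide_right_mono mult_ac)
qed

section \<open>The overlap statistic\<close>

definition overlap_excess :: "nat \<Rightarrow> (nat \<Rightarrow> int) \<Rightarrow> (nat \<Rightarrow> int) \<Rightarrow> int" where
  "overlap_excess n x y = (\<Sum>v<n. x v * y v)\<^sup>2 - int n"

text \<open>
  With denominators cleared, the tester accepts when the statistic is at most
  \<open>m * (m - 1) * (e / (n * b))\<^sup>2\<close>, which is at most half of its mean under the alternative.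
  For \<open>b = 0\<close> it always accepts.
\<close>

definition tester :: "nat \<Rightarrow> rat \<Rightarrow> rat \<Rightarrow> (nat \<Rightarrow> int) list \<Rightarrow> bool" where
  "tester n b e xs \<longleftrightarrow>
     pair_sum (overlap_excess n) xs * (int n)\<^sup>2 * (fst (quotient_of b))\<^sup>2 * (snd (quotient_of e))\<^sup>2
     \<le> int (length xs) * (int (length xs) - 1) * (fst (quotient_of e))\<^sup>2 * (snd (quotient_of b))\<^sup>2"

lemma of_rat_quotient:
  "(of_rat r :: real) = of_int (fst (quotient_of r)) / of_int (snd (quotient_of r))"
proof -
  have "r = of_int (fst (quotient_of r)) / of_int (snd (quotient_of r))"
    by (rule quotient_of_div) simp
  then have "(of_rat r :: real) = of_rat (of_int (fst (quotient_of r)) / of_int (snd (quotient_of r)))"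
    by simp
  then show ?thesis by (simp add: of_rat_divide)
qed

lemma frac_le_frac_iff:
  fixes a b c d :: real
  assumes "0 < b" "0 < d"
  shows "a / b \<le> c / d \<longleftrightarrow> a * d \<le> c * b"
  using assms by (simp add: field_simps)

lemma tester_iff:
  "tester n b e xs \<longleftrightarrow>
     real_of_int (pair_sum (overlap_excess n) xs) * (real n)\<^sup>2 * (of_rat b)\<^sup>2
     \<le> real (length xs) * (real (length xs) - 1) * (of_rat e)\<^sup>2"
proof -
  define T where "T = pair_sum (overlap_excess n) xs"
  define m where "m = length xs"
  define bn bd en ed where "bn = fst (quotient_of b)" and "bd = snd (quotient_of b)"
    and "en = fst (quotient_of e)" and "ed = snd (quotient_of e)"
  note defs = bn_def bd_def en_def ed_def
  have pos: "0 < real_of_int bd" "0 < real_of_int ed"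
    using quotient_of_denom_pos' by (simp_all add: defs)
  have b: "(of_rat b :: real) = bn / bd" and e: "(of_rat e :: real) = en / ed"
    by (simp_all add: of_rat_quotient defs)
  have "tester n b e xs \<longleftrightarrow> real_of_int (T * (int n)\<^sup>2 * bn\<^sup>2 * ed\<^sup>2)
      \<le> real_of_int (int m * (int m - 1) * en\<^sup>2 * bd\<^sup>2)"
    unfolding tester_def defs T_def m_def of_int_le_iff ..
  also have "\<dots> \<longleftrightarrow> (T * (real n)\<^sup>2 * bn\<^sup>2) * (real_of_int ed)\<^sup>2
      \<le> (real m * (real m - 1) * en\<^sup>2) * (real_of_int bd)\<^sup>2"
    by simp
  also have "\<dots> \<longleftrightarrow> (T * (real n)\<^sup>2 * bn\<^sup>2) / (real_of_int bd)\<^sup>2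
      \<le> (real m * (real m - 1) * en\<^sup>2) / (real_of_int ed)\<^sup>2"
    using pos by (intro frac_le_frac_iff[symmetric]) auto
  finally show ?thesis
    by (simp add: b e power_divide T_def m_def)
qed

context symmetric_dobrushin_cube
begin

definition offdiag_corr :: "nat \<Rightarrow> nat \<Rightarrow> real" where
  "offdiag_corr u v = (if u = v then 0 else corr u v)"

definition corr_energy :: real where
  "corr_energy = (\<Sum>u<n. \<Sum>v<n. (offdiag_corr u v)\<^sup>2)"

lemma corr_energy_nonneg: "0 \<le> corr_energy"
  unfolding corr_energy_def by (intro sum_nonneg) auto

text \<open>Serves to show that the sample bound of the far case forces at least two
  samples.\<close>

lemma corr_energy_le: "corr_energy \<le> 2 * real n / \<eta>"
proof -
  have "corr_energy \<le> (\<Sum>u<n. 2 / \<eta>)"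
    unfolding corr_energy_def
  proof (intro sum_mono)
    fix u assume "u \<in> {..<n}"
    then have "(\<Sum>v<n. (corr u v)\<^sup>2) \<le> 2 / \<eta>" by (simp add: corr_row_sum)
    moreover have "(\<Sum>v<n. (offdiag_corr u v)\<^sup>2) \<le> (\<Sum>v<n. (corr u v)\<^sup>2)"
      by (intro sum_mono) (simp add: offdiag_corr_def)
    ultimately show "(\<Sum>v<n. (offdiag_corr u v)\<^sup>2) \<le> 2 / \<eta>" by simp
  qed
  then show ?thesis by (simp add: mult.commute)
qed

lemma abs_corr_le_1:
  assumes "u < n" "v < n"
  shows "\<bar>corr u v\<bar> \<le> 1"
proof -
  have 1: "\<bar>spin x u * spin x v\<bar> = 1" if "x \<in> configs n" for x
    using spin_cases[OF that assms(1)] spin_cases[OF that assms(2)] by (auto simp: abs_mult)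
  have "corr u v \<le> ex (\<lambda>_. 1)" "ex (\<lambda>_. -1) \<le> corr u v"
    unfolding corr_def by (intro ex_mono; use 1 in \<open>force simp: abs_le_iff\<close>)+
  then show ?thesis by simp
qed

text \<open>Cauchy-Schwarz over the ordered pairs of vertices; the 4 is the square of the double
  count of unordered pairs.\<close>

lemma corr_square_sum_le:
  "4 * (\<Sum>v<n. \<Sum>u<v. \<bar>corr u v\<bar>)\<^sup>2 \<le> (real n)\<^sup>2 * corr_energy"
proof -
  let ?S = "{..<n} \<times> {..<n}"
  have "2 * (\<Sum>v<n. \<Sum>u<v. \<bar>corr u v\<bar>) = (\<Sum>v<n. \<Sum>u<n. if u = v then 0 else \<bar>corr u v\<bar>)"
    by (rule sum_offdiag[symmetric]) (simp add: corr_commute)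
  also have "\<dots> = (\<Sum>v<n. \<Sum>u<n. \<bar>offdiag_corr v u\<bar>)"
    by (intro sum.cong) (auto simp: offdiag_corr_def corr_commute)
  also have "\<dots> = (\<Sum>(v, u)\<in>?S. \<bar>offdiag_corr v u\<bar>)"
    by (simp add: sum.cartesian_product)
  finally have "(2 * (\<Sum>v<n. \<Sum>u<v. \<bar>corr u v\<bar>))\<^sup>2 = (\<Sum>z\<in>?S. 1 * \<bar>offdiag_corr (fst z) (snd z)\<bar>)\<^sup>2"
    by (simp add: case_prod_beta)
  then have "4 * (\<Sum>v<n. \<Sum>u<v. \<bar>corr u v\<bar>)\<^sup>2 = (\<Sum>z\<in>?S. 1 * \<bar>offdiag_corr (fst z) (snd z)\<bar>)\<^sup>2"
    by (simp only: power_mult_distrib) simp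
  also have "\<dots> \<le> (\<Sum>z\<in>?S. 1\<^sup>2) * (\<Sum>z\<in>?S. \<bar>offdiag_corr (fst z) (snd z)\<bar>\<^sup>2)"
    by (rule Cauchy_Schwarz_ineq_sum)
  also have "(\<Sum>z\<in>?S. \<bar>offdiag_corr (fst z) (snd z)\<bar>\<^sup>2) = corr_energy"
    by (simp add: corr_energy_def sum.cartesian_product case_prod_beta)
  finally show ?thesis by (simp add: power2_eq_square)
qed

text \<open>Substituting \<open>spin x u * spin x v = corr u v + c x u v\<close>, and likewise for
  \<open>y\<close>, expands the kernel into its Hoeffding decomposition. Subtracting
  \<open>n\<close> cancels the diagonal, where \<open>corr\<close> is 1 and \<open>c\<close>
  vanishes. The coefficients of the linear part \<open>g\<close> are the correlations, so its
  variance bound is again a multiple of \<open>corr_energy\<close>.\<close>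

lemma overlap_concentration:
  fixes p :: "(nat \<Rightarrow> int) pmf"
  assumes p: "w = pmf p" "set_pmf p = configs n" and a: "0 < a"
    and A: "\<And>xs. xs \<in> A \<Longrightarrow> length xs = m \<Longrightarrow>
       a \<le> \<bar>real_of_int (pair_sum (overlap_excess n) xs) - real m * (real m - 1) / 2 * corr_energy\<bar>"
  shows "measure_pmf.prob (replicate_pmf m p) A
    \<le> (2 * real m * (real m - 1)\<^sup>2 * (16 / \<eta>\<^sup>2 * corr_energy)
        + real m * (real m - 1) * (64 / \<eta>\<^sup>2 * (real n)\<^sup>2)) / a\<^sup>2"
proof -
  define c where "c x u v = spin x u * spin x v - corr u v" for x u v
  define g where "g x = (\<Sum>u<n. \<Sum>v<n. offdiag_corr u v * c x u v)" for x
  define r where "r x y = (\<Sum>u<n. \<Sum>v<n. c x u v * c y u v)" for x y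
  have E: "measure_pmf.expectation p f = ex f" for f :: "(nat \<Rightarrow> int) \<Rightarrow> real"
    unfolding ex_def
    by (subst integral_measure_pmf_real[where A = "configs n"]) (auto simp: p(2) p(1)[symmetric] mult.commute)
  have c_mean: "ex (\<lambda>x. c x u v) = 0" for u v
    by (simp add: c_def ex_diff corr_def)
  have of_int_pair_sum: "real_of_int (pair_sum h xs) = pair_sum (\<lambda>x y. real_of_int (h x y)) xs"
    for h :: "(nat \<Rightarrow> int) \<Rightarrow> (nat \<Rightarrow> int) \<Rightarrow> int" and xs
    by (simp add: pair_sum_def)
  show ?thesis
  proof (rule pair_sum_concentration[where g = g and r = r
        and h = "\<lambda>x y. real_of_int (overlap_excess n x y)"])
    show "finite (set_pmf p)" by (simp add: p)
    show "0 < a" by (rule a)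
    show "measure_pmf.expectation p g = 0"
      by (simp add: E g_def[abs_def] ex_sum ex_cmult c_mean)
    show "measure_pmf.expectation p (\<lambda>x. r x y) = 0" for y
      by (simp add: E r_def ex_sum ex_cmult c_mean mult.commute[of "c _ _ _" "c y _ _"])
    show "measure_pmf.expectation p (\<lambda>y. r x y) = 0" for x
      by (simp add: E r_def ex_sum ex_cmult c_mean)
    show "measure_pmf.expectation p (\<lambda>x. (g x)\<^sup>2) \<le> 16 / \<eta>\<^sup>2 * corr_energy"
      unfolding E g_def c_def corr_energy_def by (rule quadratic_variance)
    show "measure_pmf.expectation p (\<lambda>y. (r y x)\<^sup>2) \<le> 64 / \<eta>\<^sup>2 * (real n)\<^sup>2"
      if "x \<in> set_pmf p" for x
    proof -
      have x: "x \<in> configs n" using that p by simp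
      have "ex (\<lambda>y. (r y x)\<^sup>2) = ex (\<lambda>y. (\<Sum>u<n. \<Sum>v<n. c x u v * (spin y u * spin y v - corr u v))\<^sup>2)"
        by (simp add: r_def c_def mult.commute)
      also have "\<dots> \<le> 16 / \<eta>\<^sup>2 * (\<Sum>u<n. \<Sum>v<n. (c x u v)\<^sup>2)" by (rule quadratic_variance)
      also have "\<dots> \<le> 16 / \<eta>\<^sup>2 * (\<Sum>u<n. \<Sum>v<n. 4)"
      proof (intro mult_left_mono sum_mono)
        fix u v assume uv: "u \<in> {..<n}" "v \<in> {..<n}"
        \<comment> \<open>For fixed \<open>x\<close>, the \<open>n\<^sup>2\<close> coefficients have
          squares at most 4; with the factor 16 of \<open>quadratic_variance\<close> this gives
          64.\<close>
        then have "\<bar>c x u v\<bar> \<le> 2"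
          using abs_corr_le_1[of u v] spin_cases[OF x, of u] spin_cases[OF x, of v]
          by (auto simp: c_def)
        then show "(c x u v)\<^sup>2 \<le> 4" using power_mono[of "\<bar>c x u v\<bar>" 2 2] by simp
      qed simp
      also have "\<dots> = 64 / \<eta>\<^sup>2 * (real n)\<^sup>2" by (simp add: power2_eq_square)
      finally show ?thesis by (simp add: E)
    qed
    show "real_of_int (overlap_excess n x y) = corr_energy + g x + g y + r x y"
      if "x \<in> set_pmf p" "y \<in> set_pmf p" for x y
    proof -
      have xy: "x \<in> configs n" "y \<in> configs n" using that p by auto
      have diag: "(spin x u * spin y u) * (spin x u * spin y u) = 1" if "u < n" for u
        using spin_cases[OF xy(1) that] spin_cases[OF xy(2) that] by auto
      have "real_of_int (overlap_excess n x y)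
        = (\<Sum>u<n. \<Sum>v<n. (spin x u * spin y u) * (spin x v * spin y v)) - real n"
        by (simp add: overlap_excess_def power2_eq_square sum_product)
      also have "real n = (\<Sum>u<n. \<Sum>v<n. if v = u then 1 else 0)"
        by simp
      also have "(\<Sum>u<n. \<Sum>v<n. (spin x u * spin y u) * (spin x v * spin y v)) - \<dots>
        = (\<Sum>u<n. \<Sum>v<n. (offdiag_corr u v)\<^sup>2 + offdiag_corr u v * c x u v
             + offdiag_corr u v * c y u v + c x u v * c y u v)"
        unfolding sum_subtractf[symmetric]
      proof (intro sum.cong refl)
        fix u v assume uv: "u \<in> {..<n}" "v \<in> {..<n}"
        show "(spin x u * spin y u) * (spin x v * spin y v) - (if v = u then 1 else 0)
          = (offdiag_corr u v)\<^sup>2 + offdiag_corr u v * c x u v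
             + offdiag_corr u v * c y u v + c x u v * c y u v"
        proof (cases "u = v")
          case True
          then show ?thesis using uv diag[of u] xy by (simp add: offdiag_corr_def c_def corr_same)
        next
          case False
          then show ?thesis by (simp add: offdiag_corr_def c_def power2_eq_square algebra_simps)
        qed
      qed
      also have "\<dots> = corr_energy + g x + g y + r x y"
        by (simp add: corr_energy_def g_def r_def sum.distrib)
      finally show ?thesis .
    qed
    show "a \<le> \<bar>pair_sum (\<lambda>x y. real_of_int (overlap_excess n x y)) xs
        - real m * (real m - 1) / 2 * corr_energy\<bar>"
      if "xs \<in> A" "length xs = m" "set xs \<subseteq> set_pmf p" for xs
      using A[OF that(1,2)] by (simp add: of_int_pair_sum)
  qed
qed

end

section \<open>Distance to the uniform distribution, and moments of product distributions\<close>

lemma uniform_eq_Pi_pmf: "pmf_of_set (configs n) = Pi_pmf {..<n} undefined (\<lambda>_. pmf_of_set {-1, 1})"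
proof -
  have "PiE_dflt {..<n} undefined (\<lambda>_. {-1, 1 :: int}) = configs n"
    by (auto simp: PiE_dflt_def configs_def PiE_iff extensional_def)
  then show ?thesis by (subst Pi_pmf_of_set) auto
qed

lemma uniform_in_product_dists: "pmf_of_set (configs n) \<in> product_dists n"
  unfolding product_dists_def uniform_eq_Pi_pmf by auto

lemma sum_spin_mult_eq_0:
  assumes "u < n" "u \<noteq> v"
  shows "(\<Sum>x\<in>configs n. spin x u * spin x v) = 0"
proof -
  have "(\<Sum>x\<in>configs n. spin x u * spin x v) = (\<Sum>x\<in>configs n. spin (flip u x) u * spin (flip u x) v)"
    by (rule sum_flip[OF assms(1), symmetric])
  also have "\<dots> = - (\<Sum>x\<in>configs n. spin x u * spin x v)"
    using assms(2) by (simp add: flip_def sum_negf)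
  finally show ?thesis by simp
qed

text \<open>The log-ratio of the densities is the interaction plus the constant
  \<open>ln (N / Z)\<close>. The constants cancel between the two directions, and under the uniform
  distribution the interaction has mean zero.\<close>

lemma d_SKL_ising_uniform:
  fixes n :: nat and \<theta> :: "nat \<Rightarrow> nat \<Rightarrow> real"
  defines "p \<equiv> ising n (\<lambda>_. 0) \<theta>"
  shows "d_SKL p (pmf_of_set (configs n)) = ereal (\<Sum>x\<in>configs n. pmf p x * interaction n \<theta> x)"
proof -
  let ?u = "pmf_of_set (configs n)"
  let ?H = "interaction n \<theta>"
  define N where "N = real (card (configs n))"
  define Z where "Z = (\<Sum>y\<in>configs n. ising_weight n (\<lambda>_. 0) \<theta> y)"
  have Z: "Z > 0" unfolding Z_def by (intro sum_pos) (auto simp: ising_weight_def)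
  have N: "N > 0" by (simp add: N_def card_gt_0_iff)
  have set_p: "set_pmf p = configs n" by (simp add: p_def set_pmf_ising)
  have set_u: "set_pmf ?u = configs n" by simp
  have pu: "pmf p x = exp (?H x) / Z" "pmf ?u x = 1 / N" if "x \<in> configs n" for x
    using that by (simp_all add: p_def pmf_ising Z_def ising_weight_no_field N_def)
  have ln1: "ln (pmf p x / pmf ?u x) = ?H x + ln (N / Z)" if "x \<in> configs n" for x
    using Z N by (simp add: pu[OF that] ln_mult ln_div)
  have ln2: "ln (pmf ?u x / pmf p x) = - ?H x - ln (N / Z)" if "x \<in> configs n" for x
    using Z N by (simp add: pu[OF that] ln_mult ln_div)
  have mean_u: "(\<Sum>x\<in>configs n. pmf ?u x * ?H x) = 0"
  proof -
    have "(\<Sum>x\<in>configs n. ?H x) = (\<Sum>x\<in>configs n. \<Sum>v<n. \<Sum>u<v. \<theta> u v * (spin x u * spin x v))"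
      by (simp add: interaction_def mult.assoc)
    also have "\<dots> = (\<Sum>v<n. \<Sum>u<v. \<theta> u v * (\<Sum>x\<in>configs n. spin x u * spin x v))"
      by (subst sum.swap, intro sum.cong refl, subst sum.swap) (simp add: sum_distrib_left)
    also have "\<dots> = 0"
      by (intro sum.neutral ballI) (auto simp: sum_spin_mult_eq_0)
    finally have 0: "(\<Sum>x\<in>configs n. ?H x) = 0" .
    have "(\<Sum>x\<in>configs n. pmf ?u x * ?H x) = (\<Sum>x\<in>configs n. 1 / N * ?H x)"
      by (intro sum.cong refl) (simp only: pu)
    then show ?thesis using 0 by (simp add: flip: sum_divide_distrib)
  qed
  have tot: "(\<Sum>x\<in>configs n. pmf p x) = 1" "(\<Sum>x\<in>configs n. pmf ?u x) = 1"
    by (intro sum_pmf_eq_1; simp add: set_p)+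
  have "d_KL p ?u = ereal (\<Sum>x\<in>configs n. pmf p x * ?H x + pmf p x * ln (N / Z))"
    using ln1 by (subst d_KL_finite) (simp_all add: set_p distrib_left)
  moreover have "d_KL ?u p = ereal (\<Sum>x\<in>configs n. - (pmf ?u x * ?H x) - pmf ?u x * ln (N / Z))"
    using ln2 by (subst d_KL_finite) (simp_all add: set_p right_diff_distrib)
  ultimately show ?thesis
    using mean_u tot
    by (simp add: d_SKL_def sum.distrib sum_subtractf sum_negf flip: sum_distrib_right)
qed

lemma product_dists_second_moment:
  assumes p: "p \<in> product_dists n" and fin: "finite (set_pmf p)" and uv: "u < n" "v < n" "u \<noteq> v"
  shows "measure_pmf.expectation p (\<lambda>x. spin x u * spin x v)
    = measure_pmf.expectation p (\<lambda>x. spin x u) * measure_pmf.expectation p (\<lambda>x. spin x v)"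
proof -
  obtain q where q: "p = Pi_pmf {..<n} undefined q" "\<And>v. v < n \<Longrightarrow> set_pmf (q v) \<subseteq> {-1, 1}"
    using p by (auto simp: product_dists_def)
  define m where "m v = measure_pmf.expectation (q v) (\<lambda>z. real_of_int z + 1)" for v
  \<comment> \<open>The shift by 1 is there because \<open>expectation_prod_Pi_pmf\<close> wants nonnegative factors.\<close>
  have prod_E: "measure_pmf.expectation p (\<lambda>x. \<Prod>i\<in>S. spin x i + 1) = (\<Prod>i\<in>S. m i)"
    if "S \<subseteq> {..<n}" for S
  proof -
    let ?f = "\<lambda>i z. if i \<in> S then real_of_int z + 1 else 1"
    have "measure_pmf.expectation p (\<lambda>x. \<Prod>i<n. ?f i (x i)) = (\<Prod>i<n. measure_pmf.expectation (q i) (?f i))"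
      unfolding q(1)
    proof (rule expectation_prod_Pi_pmf)
      fix i assume i: "i \<in> {..<n}"
      then have "finite (set_pmf (q i))" using q(2)[of i] by (auto intro: finite_subset)
      then show "integrable (measure_pmf (q i)) (?f i)" by simp
      show "0 \<le> ?f i z" if "z \<in> set_pmf (q i)" for z
        using q(2)[of i] i that by auto
    qed simp
    moreover have "(\<Prod>i<n. ?f i (x i)) = (\<Prod>i\<in>S. spin x i + 1)" for x
      using that by (simp add: prod.If_cases Int_absorb1)
    moreover have "(\<Prod>i<n. measure_pmf.expectation (q i) (?f i)) = (\<Prod>i\<in>S. m i)"
    proof -
      have "(\<Prod>i<n. measure_pmf.expectation (q i) (?f i)) = (\<Prod>i<n. if i \<in> S then m i else 1)"
        by (intro prod.cong) (auto simp: m_def)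
      then show ?thesis using that by (simp add: prod.If_cases Int_absorb1)
    qed
    ultimately show ?thesis by simp
  qed
  have "measure_pmf.expectation p (\<lambda>x. (spin x u + 1) * (spin x v + 1))
    = measure_pmf.expectation p (\<lambda>x. spin x u + 1) * measure_pmf.expectation p (\<lambda>x. spin x v + 1)"
    using prod_E[of "{u, v}"] prod_E[of "{u}"] prod_E[of "{v}"] uv by simp
  then show ?thesis using fin by (simp add: ring_distribs)
qed

section \<open>Acceptance and rejection\<close>

text \<open>Zero means and independence make all off-diagonal correlations vanish, so only the
  degenerate part of the variance is left to compare with the threshold.\<close>

lemma tester_accepts_product:
  fixes n :: nat and \<beta> \<epsilon> \<eta> C :: real and \<theta> :: "nat \<Rightarrow> nat \<Rightarrow> real"
  defines "p \<equiv> ising n (\<lambda>_. 0) \<theta>"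
  assumes n: "n \<ge> 1" and eta: "\<eta> > 0" and beta: "\<beta> \<ge> 0" and eps: "\<epsilon> > 0"
    and approx: "approx_params \<beta> \<epsilon> b e"
    and sym: "\<And>u v. u < n \<Longrightarrow> v < n \<Longrightarrow> \<theta> u v = \<theta> v u" and ht: "high_temperature n \<eta> \<theta>"
    and C: "1 \<le> C" "327680 / \<eta>\<^sup>2 \<le> C" and m: "C * (real n ^ 3 * \<beta>\<^sup>2 / \<epsilon>\<^sup>2) \<le> real m"
    and prod: "p \<in> product_dists n"
  shows "measure_pmf.prob (replicate_pmf m p) {xs. tester n b e xs} \<ge> 9 / 10"
proof -
  have set_p: "set_pmf p = configs n" by (simp add: p_def set_pmf_ising)
  interpret symmetric_dobrushin_cube n "pmf p" "\<lambda>i j. tanh \<bar>\<theta> i j\<bar>"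
    "\<lambda>i x. pmf p (flip i x) / (pmf p x + pmf p (flip i x))" \<eta>
    unfolding p_def by (rule ising_symmetric_dobrushin[OF n eta _ ht]) (use sym in auto)
  have E: "measure_pmf.expectation p f = ex f" for f :: "(nat \<Rightarrow> int) \<Rightarrow> real"
    unfolding ex_def
    by (subst integral_measure_pmf_real[where A = "configs n"]) (auto simp: set_p mult.commute)
  have "corr u v = 0" if "u < n" "v < n" "u \<noteq> v" for u v
    using product_dists_second_moment[OF prod _ that] that by (simp add: E set_p corr_def spin_mean)
  then have energy: "corr_energy = 0"
    unfolding corr_energy_def by (intro sum.neutral ballI) (auto simp: offdiag_corr_def)
  let ?R = "{xs. \<not> tester n b e xs}"
  have "measure_pmf.prob (replicate_pmf m p) ?R \<le> 1 / 10"
  proof (cases "m \<ge> 2 \<and> \<beta> > 0")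
    case True
    define M where "M = real m * (real m - 1)"
    have M: "M > 0" "M \<ge> (real m)\<^sup>2 / 2"
      using True by (auto simp: M_def power2_eq_square field_simps)
    \<comment> \<open>The worst threshold under \<open>approx_params\<close>: \<open>e\<close> may
      be as small as \<open>\<epsilon> / 2\<close> and \<open>b\<close> as large as
      \<open>2 * \<beta>\<close>. Both are squared, hence the 16.\<close>
    define a where "a = M * \<epsilon>\<^sup>2 / (16 * (real n)\<^sup>2 * \<beta>\<^sup>2)"
    have a: "a > 0" using M True eps n by (simp add: a_def)
    have "measure_pmf.prob (replicate_pmf m p) ?R
        \<le> (2 * real m * (real m - 1)\<^sup>2 * (16 / \<eta>\<^sup>2 * corr_energy)
          + real m * (real m - 1) * (64 / \<eta>\<^sup>2 * (real n)\<^sup>2)) / a\<^sup>2"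
    proof (rule overlap_concentration[OF refl set_p a])
      fix xs assume xs: "xs \<in> ?R" "length xs = m"
      define T where "T = real_of_int (pair_sum (overlap_excess n) xs)"
      have b: "of_rat b \<le> 2 * \<beta>" "0 \<le> (of_rat b :: real)" and e: "\<epsilon> / 2 \<le> of_rat e"
        using approx beta unfolding approx_params_def by linarith+
      have rej: "M * (of_rat e)\<^sup>2 < T * (real n)\<^sup>2 * (of_rat b)\<^sup>2"
        using xs by (simp add: tester_iff T_def M_def)
      have "M * (\<epsilon> / 2)\<^sup>2 \<le> M * (of_rat e)\<^sup>2"
        using M eps e by (intro mult_left_mono power_mono) auto
      with rej have lt: "M * (\<epsilon> / 2)\<^sup>2 < T * (real n)\<^sup>2 * (of_rat b)\<^sup>2" by linarith
      have "0 < M * (\<epsilon> / 2)\<^sup>2" using M eps by simp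
      then have "0 < T * (real n)\<^sup>2 * (of_rat b)\<^sup>2" using lt by linarith
      then have T: "0 < T" by (simp add: zero_less_mult_iff)
      have "T * (real n)\<^sup>2 * (of_rat b)\<^sup>2 \<le> T * (real n)\<^sup>2 * (2 * \<beta>)\<^sup>2"
        using T b by (intro mult_left_mono power_mono) auto
      with lt have "M * (\<epsilon> / 2)\<^sup>2 \<le> T * (real n)\<^sup>2 * (2 * \<beta>)\<^sup>2" by linarith
      then have "a \<le> T" using n True by (simp add: a_def field_simps)
      then show "a \<le> \<bar>real_of_int (pair_sum (overlap_excess n) xs)
          - real m * (real m - 1) / 2 * corr_energy\<bar>"
        using T by (simp add: energy T_def)
    qed
    also have "\<dots> = M * (64 / \<eta>\<^sup>2 * (real n)\<^sup>2) / a\<^sup>2" by (simp add: energy M_def)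
    \<comment> \<open>16384 is 64 times the square of the 16 in \<open>a\<close>. The cube of
      \<open>n\<close> appears as the noise scale \<open>n\<close> times the
      \<open>n\<^sup>2\<close> of the threshold.\<close>
    also have "\<dots> = 16384 / \<eta>\<^sup>2 * (real n ^ 3 * \<beta>\<^sup>2 / \<epsilon>\<^sup>2)\<^sup>2 / M"
      using M n True eps eta by (simp add: a_def field_simps power2_eq_square power3_eq_cube)
    also have "\<dots> \<le> 16384 / \<eta>\<^sup>2 * (real m / C)\<^sup>2 / M"
      using m C M by (intro divide_right_mono mult_left_mono power_mono) (auto simp: field_simps)
    also have "\<dots> \<le> 16384 / \<eta>\<^sup>2 * (real m / C)\<^sup>2 / ((real m)\<^sup>2 / 2)"
      using M True C by (intro divide_left_mono) auto
    also have "\<dots> = 32768 / \<eta>\<^sup>2 / C / C"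
      using True C by (simp add: power2_eq_square)
    also have "\<dots> \<le> 32768 / \<eta>\<^sup>2 / C / 1"
      using C by (intro divide_left_mono) auto
    also have "\<dots> \<le> 1 / 10"
    proof -
      have "32768 / \<eta>\<^sup>2 \<le> C / 10" using C by simp
      then have "32768 / \<eta>\<^sup>2 / C \<le> 1 / 10" using C by (subst pos_divide_le_eq) auto
      then show ?thesis by (simp only: div_by_1)
    qed
    finally show ?thesis .
  next
    case False
    \<comment> \<open>Degenerate inputs are accepted surely: without a pair of samples both sides of
      the test are 0, and \<open>\<beta> = 0\<close> forces \<open>b = 0\<close>, which makes the
      left side 0.\<close>
    have "tester n b e xs" if "xs \<in> set_pmf (replicate_pmf m p)" for xs
    proof (cases "m \<ge> 2")
      case True
      then have "\<beta> = 0" using False beta by simp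
      then have "b = 0" using approx by (simp add: approx_params_def)
      then show ?thesis using that True by (simp add: tester_iff set_replicate_pmf)
    next
      case False
      have len: "length xs = m" using that by (simp add: set_replicate_pmf)
      with False have "pair_sum (overlap_excess n) xs = 0"
        by (cases xs; cases "tl xs") auto
      then show ?thesis using False len by (cases m) (auto simp: tester_iff)
    qed
    then have "measure_pmf.prob (replicate_pmf m p) ?R = 0"
      by (auto simp: measure_pmf_zero_iff)
    then show ?thesis by simp
  qed
  moreover have "measure_pmf.prob (replicate_pmf m p) {xs. tester n b e xs}
      = 1 - measure_pmf.prob (replicate_pmf m p) ?R"
    using measure_pmf.prob_compl[of ?R "replicate_pmf m p"] by (simp add: Compl_eq_Diff_UNIV[symmetric] Collect_neg_eq)
  ultimately show ?thesis by simp
qed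

text \<open>The uniform distribution is one of the product distributions, so \<epsilon> is at most
  the mean interaction energy, and hence at most \<beta> times the sum of the absolute
  correlations.\<close>

lemma tester_rejects_far:
  fixes n :: nat and \<beta> \<epsilon> \<eta> C :: real and \<theta> :: "nat \<Rightarrow> nat \<Rightarrow> real"
  defines "p \<equiv> ising n (\<lambda>_. 0) \<theta>"
  assumes n: "n \<ge> 1" and eta: "\<eta> > 0" and beta: "\<beta> \<ge> 0" and eps: "\<epsilon> > 0"
    and approx: "approx_params \<beta> \<epsilon> b e"
    and sym: "\<And>u v. u < n \<Longrightarrow> v < n \<Longrightarrow> \<theta> u v = \<theta> v u" and ht: "high_temperature n \<eta> \<theta>"
    and bound: "\<And>u v. u < n \<Longrightarrow> v < n \<Longrightarrow> u \<noteq> v \<Longrightarrow> \<bar>\<theta> u v\<bar> \<le> \<beta>"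
    and C: "1 \<le> C" "1 / \<eta> \<le> C" "2560 / \<eta>\<^sup>2 \<le> C"
    and m: "C * (real n ^ 3 * \<beta>\<^sup>2 / \<epsilon>\<^sup>2) \<le> real m"
    and far: "d_SKL_set p (product_dists n) \<ge> ereal \<epsilon>"
  shows "measure_pmf.prob (replicate_pmf m p) {xs. \<not> tester n b e xs} \<ge> 9 / 10"
proof -
  have set_p: "set_pmf p = configs n" by (simp add: p_def set_pmf_ising)
  interpret symmetric_dobrushin_cube n "pmf p" "\<lambda>i j. tanh \<bar>\<theta> i j\<bar>"
    "\<lambda>i x. pmf p (flip i x) / (pmf p x + pmf p (flip i x))" \<eta>
    unfolding p_def by (rule ising_symmetric_dobrushin[OF n eta _ ht]) (use sym in auto)
  define L where "L = (\<Sum>v<n. \<Sum>u<v. \<bar>corr u v\<bar>)"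
  have "ereal \<epsilon> \<le> d_SKL p (pmf_of_set (configs n))"
    using far INF_lower[OF uniform_in_product_dists] unfolding d_SKL_set_def by (rule order_trans)
  then have "\<epsilon> \<le> (\<Sum>x\<in>configs n. pmf p x * interaction n \<theta> x)"
    unfolding p_def d_SKL_ising_uniform by simp
  also have "\<dots> = ex (interaction n \<theta>)" by (simp add: ex_def)
  also have "\<dots> = (\<Sum>v<n. \<Sum>u<v. \<theta> u v * corr u v)"
    by (simp add: interaction_def[abs_def] ex_sum mult.assoc ex_cmult corr_def)
  also have "\<dots> \<le> (\<Sum>v<n. \<Sum>u<v. \<beta> * \<bar>corr u v\<bar>)"
  proof (intro sum_mono)
    fix u v assume "v \<in> {..<n}" "u \<in> {..<v}"
    then have "\<bar>\<theta> u v\<bar> * \<bar>corr u v\<bar> \<le> \<beta> * \<bar>corr u v\<bar>"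
      by (intro mult_right_mono bound) auto
    then show "\<theta> u v * corr u v \<le> \<beta> * \<bar>corr u v\<bar>"
      by (simp add: abs_mult[symmetric])
  qed
  also have "\<dots> = \<beta> * L" by (simp add: L_def sum_distrib_left)
  finally have eps_L: "\<epsilon> \<le> \<beta> * L" .
  then have beta_pos: "\<beta> > 0" using eps beta by (cases "\<beta> = 0") auto
  have "4 * \<epsilon>\<^sup>2 \<le> 4 * (\<beta> * L)\<^sup>2" using eps_L eps by (intro mult_left_mono power_mono) auto
  also have "\<dots> = \<beta>\<^sup>2 * (4 * L\<^sup>2)" by (simp add: power_mult_distrib)
  also have "\<dots> \<le> \<beta>\<^sup>2 * ((real n)\<^sup>2 * corr_energy)"
    unfolding L_def by (intro mult_left_mono corr_square_sum_le) auto
  finally have signal: "4 * \<epsilon>\<^sup>2 \<le> \<beta>\<^sup>2 * (real n)\<^sup>2 * corr_energy" by (simp add: mult_ac)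
  then have energy: "corr_energy > 0"
    using eps corr_energy_nonneg by (cases "corr_energy = 0") auto
  \<comment> \<open>Signal-to-noise parameter: relative to the squared signal, the linear part of
    the variance is of order \<open>1 / S\<close> and the degenerate part of order
    \<open>(real n)\<^sup>2 / S\<^sup>2\<close>.\<close>
  define S where "S = real m * corr_energy"
  have S: "4 * C * real n \<le> S"
  proof -
    have "4 * C * real n * \<epsilon>\<^sup>2 = C * real n * (4 * \<epsilon>\<^sup>2)" by simp
    also have "\<dots> \<le> C * real n * (\<beta>\<^sup>2 * (real n)\<^sup>2 * corr_energy)"
      using signal C by (intro mult_left_mono) auto
    also have "\<dots> = (C * (real n ^ 3 * \<beta>\<^sup>2 / \<epsilon>\<^sup>2)) * corr_energy * \<epsilon>\<^sup>2"
      using eps by (simp add: power2_eq_square power3_eq_cube)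
    also have "\<dots> \<le> S * \<epsilon>\<^sup>2"
      unfolding S_def using m energy by (intro mult_right_mono) auto
    finally show ?thesis using eps by simp
  qed
  \<comment> \<open>With fewer than two samples the tester accepts, so this has to follow from the
    sample bound. It does, since \<open>S\<close> is at least \<open>4 * C * real n\<close> while
    the energy is at most \<open>2 * real n / \<eta>\<close>.\<close>
  have m2: "2 \<le> real m"
  proof -
    have "4 * C * real n \<le> real m * (2 * real n / \<eta>)"
      using S mult_left_mono[OF corr_energy_le, of "real m"] by (simp add: S_def)
    then have "2 * (C * \<eta>) \<le> real m" using n eta by (simp add: field_simps)
    moreover have "1 \<le> C * \<eta>" using C eta by (simp add: field_simps)
    ultimately show ?thesis by linarith
  qed
  define M where "M = real m * (real m - 1)"
  have M: "M > 0" "M \<ge> (real m)\<^sup>2 / 2"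
    using m2 by (auto simp: M_def power2_eq_square field_simps)
  \<comment> \<open>The mean of the statistic is \<open>M * corr_energy / 2\<close>, and
    \<open>signal\<close> puts every accepted value at or below half of it.\<close>
  define a where "a = M * corr_energy / 4"
  have a: "a > 0" using M energy by (simp add: a_def)
  have "measure_pmf.prob (replicate_pmf m p) {xs. tester n b e xs}
      \<le> (2 * real m * (real m - 1)\<^sup>2 * (16 / \<eta>\<^sup>2 * corr_energy)
        + real m * (real m - 1) * (64 / \<eta>\<^sup>2 * (real n)\<^sup>2)) / a\<^sup>2"
  proof (rule overlap_concentration[OF refl set_p a])
    fix xs assume xs: "xs \<in> {xs. tester n b e xs}" "length xs = m"
    define T where "T = real_of_int (pair_sum (overlap_excess n) xs)"
    have b: "\<beta> \<le> of_rat b" and e: "of_rat e \<le> \<epsilon>" "0 \<le> (of_rat e :: real)"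
      using approx eps unfolding approx_params_def by linarith+
    have acc: "T * (real n)\<^sup>2 * (of_rat b)\<^sup>2 \<le> M * (of_rat e)\<^sup>2"
      using xs by (simp add: tester_iff T_def M_def)
    have "T \<le> M * corr_energy / 4"
    proof (cases "T > 0")
      case True
      have "T * (real n)\<^sup>2 * \<beta>\<^sup>2 \<le> T * (real n)\<^sup>2 * (of_rat b)\<^sup>2"
        using True b beta by (intro mult_left_mono power_mono) auto
      also note acc
      also have "M * (of_rat e)\<^sup>2 \<le> M * \<epsilon>\<^sup>2"
        using M e by (intro mult_left_mono power_mono) auto
      also have "\<dots> \<le> M * (\<beta>\<^sup>2 * (real n)\<^sup>2 * corr_energy / 4)"
        using M signal by (intro mult_left_mono) auto
      finally have "T * ((real n)\<^sup>2 * \<beta>\<^sup>2) \<le> M * corr_energy / 4 * ((real n)\<^sup>2 * \<beta>\<^sup>2)"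
        by (simp add: mult_ac)
      then show ?thesis using n beta_pos by simp
    next
      case False
      moreover have "0 \<le> M * corr_energy / 4" using M energy by simp
      ultimately show ?thesis by linarith
    qed
    then show "a \<le> \<bar>real_of_int (pair_sum (overlap_excess n) xs)
        - real m * (real m - 1) / 2 * corr_energy\<bar>"
      unfolding T_def[symmetric] M_def[symmetric] a_def using M energy by (simp add: abs_if)
  qed
  also have "\<dots> = 512 / \<eta>\<^sup>2 / S + 1024 / \<eta>\<^sup>2 * (real n)\<^sup>2 / (M * corr_energy\<^sup>2)"
    using m2 energy eta by (simp add: a_def M_def S_def divide_simps power2_eq_square)
      (simp add: algebra_simps)?
  also have "\<dots> \<le> 512 / \<eta>\<^sup>2 / (4 * C * real n) + 1024 / \<eta>\<^sup>2 * (real n)\<^sup>2 / (S\<^sup>2 / 2)"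
  proof (intro add_mono divide_left_mono S)
    show "S\<^sup>2 / 2 \<le> M * corr_energy\<^sup>2"
      using mult_right_mono[OF M(2), of "corr_energy\<^sup>2"] by (simp add: S_def power_mult_distrib)
    show "0 < S * (4 * C * real n)" "0 < M * corr_energy\<^sup>2 * (S\<^sup>2 / 2)"
      using m2 energy M C n by (simp_all add: S_def)
  qed auto
  also have "\<dots> \<le> 512 / \<eta>\<^sup>2 / (4 * C * real n) + 1024 / \<eta>\<^sup>2 * (real n)\<^sup>2 / ((4 * C * real n)\<^sup>2 / 2)"
  proof (intro add_left_mono divide_left_mono divide_right_mono power_mono S)
    have "0 < S" "0 < 4 * C * real n" using m2 energy C n by (simp_all add: S_def)
    then show "0 < S\<^sup>2 / 2 * ((4 * C * real n)\<^sup>2 / 2)"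
      by (intro mult_pos_pos divide_pos_pos zero_less_power) (use C n in auto)
  qed (use C n in auto)
  also have "\<dots> = 128 / \<eta>\<^sup>2 / C / real n + 128 / \<eta>\<^sup>2 / C / C"
    using C n eta by (simp add: field_simps power2_eq_square)
  also have "\<dots> \<le> 128 / \<eta>\<^sup>2 / C / 1 + 128 / \<eta>\<^sup>2 / C / 1"
    using C n by (intro add_mono divide_left_mono) auto
  also have "\<dots> \<le> 1 / 10"
  proof -
    \<comment> \<open>The two variance terms get an error budget of 1/20 each; 2560 is 20 times
      128.\<close>
    have "128 / \<eta>\<^sup>2 \<le> C / 20" using C by simp
    then have "128 / \<eta>\<^sup>2 / C \<le> 1 / 20" using C by (subst pos_divide_le_eq) auto
    then show ?thesis by linarith
  qed
  finally have "measure_pmf.prob (replicate_pmf m p) {xs. tester n b e xs} \<le> 1 / 10" .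
  moreover have "measure_pmf.prob (replicate_pmf m p) {xs. \<not> tester n b e xs}
      = 1 - measure_pmf.prob (replicate_pmf m p) {xs. tester n b e xs}"
    using measure_pmf.prob_compl[of "{xs. tester n b e xs}" "replicate_pmf m p"]
    by (simp add: Compl_eq_Diff_UNIV[symmetric] Collect_neg_eq)
  ultimately show ?thesis by simp
qed

section \<open>A program for the tester\<close>

fun expr_size :: "expr \<Rightarrow> nat" where
  "expr_size (Const z) = 1"
| "expr_size (Load a) = Suc (expr_size a)"
| "expr_size (Plus a b) = Suc (expr_size a + expr_size b)"
| "expr_size (Minus a b) = Suc (expr_size a + expr_size b)"
| "expr_size (Times a b) = Suc (expr_size a + expr_size b)"
| "expr_size (Div a b) = Suc (expr_size a + expr_size b)"

fun const_bound :: "int \<Rightarrow> expr \<Rightarrow> bool" where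
  "const_bound M (Const z) \<longleftrightarrow> \<bar>z\<bar> \<le> M"
| "const_bound M (Load a) \<longleftrightarrow> const_bound M a"
| "const_bound M (Plus a b) \<longleftrightarrow> const_bound M a \<and> const_bound M b"
| "const_bound M (Minus a b) \<longleftrightarrow> const_bound M a \<and> const_bound M b"
| "const_bound M (Times a b) \<longleftrightarrow> const_bound M a \<and> const_bound M b"
| "const_bound M (Div a b) \<longleftrightarrow> const_bound M a \<and> const_bound M b"

lemma abs_div_le: "\<bar>a div b\<bar> \<le> \<bar>a\<bar>" for a b :: int
proof -
  have pos: "\<bar>a div b\<bar> \<le> \<bar>a\<bar>" if "0 < b" for a b :: int
  proof (cases "0 \<le> a")
    case True
    then show ?thesis
      using zdiv_mono2[of a 1 b] pos_imp_zdiv_nonneg_iff[OF that, of a] that by simp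
  next
    case False
    have "a * b div b \<le> a div b"
      using mult_left_mono_neg[of 1 b a] False that by (intro zdiv_mono1) auto
    moreover have "a div b \<le> 0 div b" using False that by (intro zdiv_mono1) auto
    ultimately show ?thesis using False that by simp
  qed
  show ?thesis
    using pos[of b a] pos[of "- b" "- a"] by (cases "b = 0") (auto simp: linorder_neq_iff)
qed

text \<open>Adding two values costs at most a factor 2, which the extra power of \<open>M\<close>
  for the node absorbs. A load returns a cell content, bounded by \<open>M\<close> whatever the
  address.\<close>

lemma abs_eval_expr_le:
  assumes M: "2 \<le> M" and s: "\<And>a. \<bar>s a\<bar> \<le> M" and e: "const_bound M e"
  shows "\<bar>eval_expr e s\<bar> \<le> M ^ expr_size e"
  using e
proof (induction e)
  case (Const z)
  then show ?case by simp
next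
  case (Load a)
  have "M ^ 1 \<le> M ^ expr_size (Load a)" using M by (intro power_increasing) auto
  then show ?case using s[of "eval_expr a s"] by simp
next
  case (Plus a b)
  have "M ^ expr_size a \<le> M ^ (expr_size a + expr_size b)"
    "M ^ expr_size b \<le> M ^ (expr_size a + expr_size b)"
    by (intro power_increasing; use M in simp)+
  then have "M ^ expr_size a + M ^ expr_size b \<le> 2 * M ^ (expr_size a + expr_size b)" by linarith
  also have "\<dots> \<le> M * M ^ (expr_size a + expr_size b)" using M by (intro mult_right_mono) auto
  finally show ?case using Plus by simp
next
  case (Minus a b)
  have "M ^ expr_size a \<le> M ^ (expr_size a + expr_size b)"
    "M ^ expr_size b \<le> M ^ (expr_size a + expr_size b)"
    by (intro power_increasing; use M in simp)+
  then have "M ^ expr_size a + M ^ expr_size b \<le> 2 * M ^ (expr_size a + expr_size b)" by linarith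
  also have "\<dots> \<le> M * M ^ (expr_size a + expr_size b)" using M by (intro mult_right_mono) auto
  finally show ?case using Minus by simp
next
  case (Times a b)
  have "\<bar>eval_expr a s\<bar> * \<bar>eval_expr b s\<bar> \<le> M ^ expr_size a * M ^ expr_size b"
    using Times by (intro mult_mono) auto
  also have "\<dots> = 1 * M ^ (expr_size a + expr_size b)" by (simp add: power_add)
  also have "\<dots> \<le> M * M ^ (expr_size a + expr_size b)" using M by (intro mult_right_mono) auto
  finally show ?case by (simp add: abs_mult)
next
  case (Div a b)
  have "\<bar>eval_expr a s div eval_expr b s\<bar> \<le> \<bar>eval_expr a s\<bar>" by (rule abs_div_le)
  also have "\<dots> \<le> M ^ expr_size a" using Div by simp
  also have "\<dots> \<le> M ^ expr_size (Div a b)" using M by (intro power_increasing) auto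
  finally show ?case by simp
qed

lemma bits_le:
  assumes "\<bar>z\<bar> \<le> 2 ^ k"
  shows "bits z \<le> k + 2"
proof -
  have "(0::int) < 2 ^ k" by simp
  with assms have "\<bar>z\<bar> < 2 ^ Suc k" unfolding power_Suc by linarith
  then have "nat \<bar>z\<bar> < 2 ^ Suc k" by (simp add: nat_less_iff)
  then have "floorlog 2 (nat \<bar>z\<bar>) \<le> Suc k" by (intro floorlog_leI) auto
  then show ?thesis by (simp add: bits_def)
qed

lemma abs_less_bits: "\<bar>z\<bar> < 2 ^ bits z"
proof -
  have "nat \<bar>z\<bar> < 2 ^ floorlog 2 (nat \<bar>z\<bar>)"
    by (rule floorlog_leD) auto
  also have "\<dots> \<le> 2 ^ bits z" by (simp add: bits_def)
  finally show ?thesis by (simp add: nat_less_iff)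
qed

text \<open>There are \<open>expr_size e\<close> nodes, and each is charged the bit length of a
  value of absolute value at most \<open>2 ^ (B * expr_size e)\<close>.\<close>

lemma cost_expr_le:
  assumes B: "1 \<le> B" and s: "\<And>a. \<bar>s a\<bar> \<le> 2 ^ B" and e: "const_bound (2 ^ B) e"
  shows "cost_expr e s \<le> expr_size e * (B * expr_size e + 2)"
proof -
  have "(2::int) ^ 1 \<le> 2 ^ B" using B by (intro power_increasing) auto
  then have M: "(2::int) \<le> 2 ^ B" by simp
  have node: "bits (eval_expr e s) \<le> B * expr_size e + 2" if "const_bound (2 ^ B) e" for e
    using abs_eval_expr_le[OF M s that] by (intro bits_le) (simp add: power_mult)
  define L where "L = B * expr_size e + 2"
  have nodeL: "bits (eval_expr e' s) \<le> L"
    if "const_bound (2 ^ B) e'" "expr_size e' \<le> expr_size e" for e'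
    using node[OF that(1)] mult_le_mono2[OF that(2), of B] unfolding L_def by linarith
  have "cost_expr e' s \<le> expr_size e' * L"
    if "const_bound (2 ^ B) e'" "expr_size e' \<le> expr_size e" for e'
    using that
  proof (induction e')
    case (Const z)
    then show ?case using nodeL[of "Const z"] by (simp add: ring_distribs)
  next
    case (Load a)
    then show ?case using nodeL[of "Load a"] by (simp add: ring_distribs)
  next
    case (Plus a b)
    then show ?case using nodeL[of "Plus a b"] by (simp add: ring_distribs)
  next
    case (Minus a b)
    then show ?case using nodeL[of "Minus a b"] by (simp add: ring_distribs)
  next
    case (Times a b)
    then show ?case using nodeL[of "Times a b"] by (simp add: ring_distribs)
  next
    case (Div a b)
    then show ?case using nodeL[of "Div a b"] by (simp add: ring_distribs)
  qed
  then show ?thesis using e by (simp add: L_def)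
qed

section \<open>Composition of programs with upper bounds on their cost\<close>

definition runs :: "prog \<Rightarrow> memory \<Rightarrow> nat \<Rightarrow> memory \<Rightarrow> bool" where
  "runs c s T s' \<longleftrightarrow> (\<exists>t\<le>T. exec c s t s')"

lemma runs_mono: "runs c s T s' \<Longrightarrow> T \<le> T' \<Longrightarrow> runs c s T' s'"
  unfolding runs_def by (meson order_trans)

lemma runs_Store:
  assumes "cost_expr a s \<le> W" "cost_expr b s \<le> W" "s' = s(eval_expr a s := eval_expr b s)"
  shows "runs (Store a b) s (1 + 2 * W) s'"
proof -
  have "1 + cost_expr a s + cost_expr b s \<le> 1 + 2 * W" using assms by simp
  then show ?thesis unfolding runs_def assms(3) using exec.Store by blast
qed

lemma runs_Seq:
  assumes "runs c\<^sub>1 s T\<^sub>1 s'" "runs c\<^sub>2 s' T\<^sub>2 s''"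
  shows "runs (Seq c\<^sub>1 c\<^sub>2) s (1 + T\<^sub>1 + T\<^sub>2) s''"
proof -
  obtain t\<^sub>1 t\<^sub>2 where t: "t\<^sub>1 \<le> T\<^sub>1" "exec c\<^sub>1 s t\<^sub>1 s'" "t\<^sub>2 \<le> T\<^sub>2" "exec c\<^sub>2 s' t\<^sub>2 s''"
    using assms by (auto simp: runs_def)
  then have "1 + t\<^sub>1 + t\<^sub>2 \<le> 1 + T\<^sub>1 + T\<^sub>2" by simp
  then show ?thesis unfolding runs_def using exec.Seq[OF t(2,4)] by blast
qed

lemma runs_If:
  assumes "cost_expr b s \<le> W" "runs (if eval_expr b s > 0 then c\<^sub>1 else c\<^sub>2) s T s'"
  shows "runs (If b c\<^sub>1 c\<^sub>2) s (1 + W + T) s'"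
proof -
  obtain t where t: "t \<le> T" "exec (if eval_expr b s > 0 then c\<^sub>1 else c\<^sub>2) s t s'"
    using assms(2) by (auto simp: runs_def)
  have "exec (If b c\<^sub>1 c\<^sub>2) s (1 + cost_expr b s + t) s'"
  proof (cases "eval_expr b s > 0")
    case True
    then show ?thesis using t by (intro exec.IfTrue) auto
  next
    case False
    then show ?thesis using t by (intro exec.IfFalse) auto
  qed
  moreover have "1 + cost_expr b s + t \<le> 1 + W + T" using t(1) assms(1) by simp
  ultimately show ?thesis unfolding runs_def by blast
qed

lemma runs_While:
  assumes body: "\<And>i. i < L \<Longrightarrow> eval_expr b (S i) > 0 \<and> runs c (S i) T (S (Suc i))"
    and stop: "eval_expr b (S L) \<le> 0"
    and guard: "\<And>i. i \<le> L \<Longrightarrow> cost_expr b (S i) \<le> G"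
  shows "runs (While b c) (S 0) (L * (2 + G + T) + 1 + G) (S L)"
proof -
  \<comment> \<open>Induction on the number \<open>k\<close> of remaining iterations, because the
    semantics unfolds a loop at its first iteration.\<close>
  have "runs (While b c) (S (L - k)) (k * (2 + G + T) + 1 + G) (S L)" if "k \<le> L" for k
    using that
  proof (induction k)
    case 0
    then show ?case using exec.WhileFalse[OF stop] guard[of L] by (force simp: runs_def)
  next
    case (Suc k)
    let ?i = "L - Suc k"
    have i: "?i < L" "Suc ?i = L - k" using Suc.prems by auto
    obtain t1 where t1: "t1 \<le> T" "exec c (S ?i) t1 (S (L - k))"
      using body[OF i(1)] by (auto simp: runs_def i(2))
    obtain t2 where t2: "t2 \<le> k * (2 + G + T) + 1 + G" "exec (While b c) (S (L - k)) t2 (S L)"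
      using Suc by (auto simp: runs_def)
    have "exec (While b c) (S ?i) (1 + cost_expr b (S ?i) + t1 + t2) (S L)"
      using body[OF i(1)] t1 t2 by (intro exec.WhileTrue) auto
    moreover have "1 + cost_expr b (S ?i) + t1 + t2 \<le> Suc k * (2 + G + T) + 1 + G"
      using t1(1) t2(1) guard[of ?i] by simp
    ultimately show ?case unfolding runs_def by blast
  qed
  from this[of L] show ?thesis by simp
qed

text \<open>
  Working variables live at negative addresses, away from the input: the indices \<open>j < i\<close> of the
  current pair of samples, a coordinate \<open>k\<close>, the partial inner product \<open>d\<close> and the partial
  statistic \<open>u\<close>.
\<close>

definition store_state :: "memory \<Rightarrow> int \<Rightarrow> int \<Rightarrow> int \<Rightarrow> int \<Rightarrow> int \<Rightarrow> memory" where
  "store_state w i j k d u = w(-1 := i, -2 := j, -3 := k, -4 := d, -5 := u)"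

abbreviation Cell :: "int \<Rightarrow> expr" where
  "Cell a \<equiv> Load (Const a)"

text \<open>The samples are stored row by row after six header cells. The argument is the address of
  the index variable, not the index itself.\<close>

definition sample_entry :: "int \<Rightarrow> expr" where
  "sample_entry i = Load (Plus (Const 6) (Plus (Times (Cell i) (Cell 0)) (Cell (-3))))"

definition dot_body :: prog where
  "dot_body = Seq
     (Store (Const (-4)) (Plus (Cell (-4)) (Times (sample_entry (-1)) (sample_entry (-2)))))
     (Store (Const (-3)) (Plus (Cell (-3)) (Const 1)))"

text \<open>The inner product and the coordinate are reset at the end, so that every pair starts
  from a state of the same shape.\<close>

definition row_body :: prog where
  "row_body = Seq (While (Minus (Cell 0) (Cell (-3))) dot_body)
     (Seq (Store (Const (-5)) (Plus (Cell (-5)) (Minus (Times (Cell (-4)) (Cell (-4))) (Cell 0))))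
     (Seq (Store (Const (-4)) (Const 0))
     (Seq (Store (Const (-3)) (Const 0))
          (Store (Const (-2)) (Plus (Cell (-2)) (Const 1))))))"

definition pair_body :: prog where
  "pair_body = Seq (While (Minus (Cell (-1)) (Cell (-2))) row_body)
     (Seq (Store (Const (-2)) (Const 0))
          (Store (Const (-1)) (Plus (Cell (-1)) (Const 1))))"

text \<open>Positive exactly when the tester rejects. Cells 2 to 5 hold the numerators and
  denominators of the parameters, so the comparison stays in the integers.\<close>

definition verdict :: expr where
  "verdict = Minus
     (Times (Times (Cell (-5)) (Times (Cell 0) (Cell 0)))
        (Times (Times (Cell 2) (Cell 2)) (Times (Cell 5) (Cell 5))))
     (Times (Times (Cell 1) (Minus (Cell 1) (Const 1)))
        (Times (Times (Cell 4) (Cell 4)) (Times (Cell 3) (Cell 3))))"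

definition tester_prog :: prog where
  "tester_prog = Seq (While (Minus (Cell 1) (Cell (-1))) pair_body)
     (If verdict (Store (Const 0) (Const 0)) (Store (Const 0) (Const 1)))"

text \<open>\<open>X i l\<close> is coordinate \<open>l\<close> of sample \<open>i\<close>. The bit
  budget \<open>B\<close> must cover the input cells and, through \<open>nm_bound\<close>, every
  partial value of the statistic.\<close>

locale tester_run =
  fixes w :: memory and n m B :: nat and X :: "nat \<Rightarrow> nat \<Rightarrow> int"
  assumes w0: "w 0 = int n" and w1: "w 1 = int m"
    and w_neg: "\<And>a. a < 0 \<Longrightarrow> w a = 0"
    and w_entry: "\<And>i l. i < m \<Longrightarrow> l < n \<Longrightarrow> w (6 + (int i * int n + int l)) = X i l"
    and X_bound: "\<And>i l. i < m \<Longrightarrow> l < n \<Longrightarrow> \<bar>X i l\<bar> \<le> 1"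
    and B: "3 \<le> B" and w_bound: "\<And>a. \<bar>w a\<bar> \<le> 2 ^ B"
    and nm_bound: "int m * int m * (int n * int n) \<le> 2 ^ B"
begin

definition dot :: "nat \<Rightarrow> nat \<Rightarrow> nat \<Rightarrow> int" where
  "dot i j k = (\<Sum>l<k. X i l * X j l)"

definition excess :: "nat \<Rightarrow> nat \<Rightarrow> int" where
  "excess i j = dot i j n * dot i j n - int n"

definition cap :: int where "cap = 2 ^ B"

text \<open>A common cost bound for all expressions of the program: 40 is the size of
  \<open>verdict\<close>, the largest one.\<close>

definition W :: nat where "W = 40 * (B * 40 + 2)"

lemma cap_nonneg [simp]: "0 \<le> cap"
  by (simp add: cap_def)

lemma store_state_simps [simp]:
  "store_state w i j k d u (-1) = i" "store_state w i j k d u (-2) = j"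
  "store_state w i j k d u (-3) = k" "store_state w i j k d u (-4) = d"
  "store_state w i j k d u (-5) = u"
  "0 \<le> a \<Longrightarrow> store_state w i j k d u a = w a"
  by (simp_all add: store_state_def)

lemma store_state_upd [simp]:
  "(store_state w i j k d u)(-1 := x) = store_state w x j k d u"
  "(store_state w i j k d u)(-2 := x) = store_state w i x k d u"
  "(store_state w i j k d u)(-3 := x) = store_state w i j x d u"
  "(store_state w i j k d u)(-4 := x) = store_state w i j k x u"
  "(store_state w i j k d u)(-5 := x) = store_state w i j k d x"
  by (auto simp: store_state_def fun_eq_iff)

text \<open>The constants of the program stay below 8, a power of two that the assumption
  \<open>3 \<le> B\<close> fits into the bit budget.\<close>

lemma cost_le_W:
  assumes "const_bound 8 e" "expr_size e \<le> 40"
    and "\<bar>i\<bar> \<le> cap" "\<bar>j\<bar> \<le> cap" "\<bar>k\<bar> \<le> cap" "\<bar>d\<bar> \<le> cap" "\<bar>u\<bar> \<le> cap"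
  shows "cost_expr e (store_state w i j k d u) \<le> W"
proof -
  have "(2::int) ^ 3 \<le> 2 ^ B" using B by (intro power_increasing) auto
  then have eight: "(8::int) \<le> 2 ^ B" by simp
  have cb: "const_bound M e \<Longrightarrow> M \<le> M' \<Longrightarrow> const_bound M' e" for M M' e
    by (induction e) auto
  have "cost_expr e (store_state w i j k d u) \<le> expr_size e * (B * expr_size e + 2)"
    by (rule cost_expr_le) (use B assms w_bound cb[OF _ eight] in \<open>auto simp: store_state_def cap_def\<close>)
  also have "\<dots> \<le> W" unfolding W_def by (intro mult_mono add_mono) (use assms in auto)
  finally show ?thesis .
qed

lemma abs_dot_le: "i < m \<Longrightarrow> j < m \<Longrightarrow> k \<le> n \<Longrightarrow> \<bar>dot i j k\<bar> \<le> int k"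
proof -
  assume *: "i < m" "j < m" "k \<le> n"
  have "\<bar>dot i j k\<bar> \<le> (\<Sum>l<k. \<bar>X i l * X j l\<bar>)" unfolding dot_def by (rule sum_abs)
  also have "\<dots> \<le> (\<Sum>l<k. 1)"
  proof (intro sum_mono)
    fix l assume "l \<in> {..<k}"
    then have "\<bar>X i l\<bar> * \<bar>X j l\<bar> \<le> 1 * 1" using * by (intro mult_mono X_bound) auto
    then show "\<bar>X i l * X j l\<bar> \<le> 1" by (simp add: abs_mult)
  qed
  finally show ?thesis by simp
qed

lemma abs_excess_le:
  assumes "i < m" "j < m"
  shows "\<bar>excess i j\<bar> \<le> int n * int n"
proof -
  have "\<bar>dot i j n\<bar> * \<bar>dot i j n\<bar> \<le> int n * int n"
    using abs_dot_le[OF assms order_refl] by (intro mult_mono) auto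
  moreover have "int n \<le> int n * int n" by (cases n) auto
  moreover have "0 \<le> dot i j n * dot i j n" by simp
  ultimately show ?thesis unfolding excess_def abs_mult[symmetric] by linarith
qed

text \<open>Loop invariant: the statistic accumulated just before the pair with indices
  \<open>i\<close> and \<open>j\<close> is processed.\<close>

definition partial :: "nat \<Rightarrow> nat \<Rightarrow> int" where
  "partial i j = (\<Sum>i'<i. \<Sum>j'<i'. excess i' j') + (\<Sum>j'<j. excess i j')"

text \<open>The two alternatives are the states within a row and the states between rows; only the
  latter include the final \<open>i = m\<close>.\<close>

lemma abs_partial_le:
  assumes ij: "i < m \<and> j \<le> i \<or> i \<le> m \<and> j = 0"
  shows "\<bar>partial i j\<bar> \<le> cap"
proof -
  have sq: "0 \<le> int n * int n" by simp
  have inner: "\<bar>\<Sum>j'<j. excess i j'\<bar> \<le> int m * (int n * int n)" if "i < m" "j \<le> i" for i j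
  proof -
    have "\<bar>\<Sum>j'<j. excess i j'\<bar> \<le> (\<Sum>j'<j. \<bar>excess i j'\<bar>)" by (rule sum_abs)
    also have "\<dots> \<le> (\<Sum>j'<j. int n * int n)" by (intro sum_mono abs_excess_le) (use that in auto)
    also have "\<dots> = int j * (int n * int n)" by simp
    also have "\<dots> \<le> int m * (int n * int n)" using that by (intro mult_right_mono sq) auto
    finally show ?thesis .
  qed
  have outer: "\<bar>\<Sum>i'<i. \<Sum>j'<i'. excess i' j'\<bar> \<le> int i * (int m * (int n * int n))"
  proof -
    have "\<bar>\<Sum>i'<i. \<Sum>j'<i'. excess i' j'\<bar> \<le> (\<Sum>i'<i. \<bar>\<Sum>j'<i'. excess i' j'\<bar>)" by (rule sum_abs)
    also have "\<dots> \<le> (\<Sum>i'<i. int m * (int n * int n))"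
      by (intro sum_mono inner) (use ij in auto)
    finally show ?thesis by simp
  qed
  have "\<bar>partial i j\<bar> \<le> int m * (int m * (int n * int n))"
  proof (cases "i < m \<and> j \<le> i")
    case True
    then have "\<bar>partial i j\<bar> \<le> (int i + 1) * (int m * (int n * int n))"
      using outer inner[of i j] unfolding partial_def by (simp add: ring_distribs)
    also have "\<dots> \<le> int m * (int m * (int n * int n))"
      using True by (intro mult_right_mono) auto
    finally show ?thesis .
  next
    case False
    then have "\<bar>partial i j\<bar> \<le> int i * (int m * (int n * int n))"
      using outer ij unfolding partial_def by auto
    also have "\<dots> \<le> int m * (int m * (int n * int n))"
      using False ij by (intro mult_right_mono) auto
    finally show ?thesis .
  qed
  then show ?thesis using nm_bound unfolding cap_def by (simp add: mult_ac)
qed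

lemma counter_bounds: "k \<le> n \<Longrightarrow> int k \<le> cap" "i \<le> m \<Longrightarrow> int i \<le> cap"
  using w_bound[of 0] w_bound[of 1] unfolding cap_def w0 w1 by linarith+

lemma run_dot_loop:
  assumes ij: "i < m" "j < i" and u: "\<bar>u\<bar> \<le> cap"
  shows "runs (While (Minus (Cell 0) (Cell (-3))) dot_body)
    (store_state w i j 0 0 u) (n * (5 + 5 * W) + 1 + W) (store_state w i j n (dot i j n) u)"
proof -
  define S where "S k = store_state w i j (int k) (dot i j k) u" for k
  have cost: "cost_expr e (store_state w i j (int k) d u) \<le> W"
    if "const_bound 8 e" "expr_size e \<le> 40" "k \<le> n" "\<bar>d\<bar> \<le> cap" for e k d
    using that ij u counter_bounds by (intro cost_le_W) auto
  have dot_le: "\<bar>dot i j k\<bar> \<le> cap" if "k \<le> n" for k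
    using abs_dot_le[of i j k] counter_bounds(1)[OF that] ij that by linarith
  have "runs (While (Minus (Cell 0) (Cell (-3))) dot_body) (S 0)
    (n * (2 + W + (1 + (1 + 2 * W) + (1 + 2 * W))) + 1 + W) (S n)"
  proof (rule runs_While)
    fix k assume k: "k < n"
    have entries: "w (6 + (int i * int n + int k)) = X i k" "w (6 + (int j * int n + int k)) = X j k"
      using w_entry[of i k] w_entry[of j k] ij k by auto
    have dot_Suc: "dot i j (Suc k) = dot i j k + X i k * X j k" by (simp add: dot_def)
    have "runs (Store (Const (-4)) (Plus (Cell (-4)) (Times (sample_entry (-1)) (sample_entry (-2)))))
       (S k) (1 + 2 * W) (store_state w i j (int k) (dot i j (Suc k)) u)"
      unfolding S_def
      by (rule runs_Store[OF cost cost])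
        (use k dot_le entries in \<open>simp_all add: sample_entry_def w0 dot_Suc\<close>)
    moreover have "runs (Store (Const (-3)) (Plus (Cell (-3)) (Const 1)))
       (store_state w i j (int k) (dot i j (Suc k)) u) (1 + 2 * W) (S (Suc k))"
      unfolding S_def
      by (rule runs_Store[OF cost cost]) (use k dot_le[of "Suc k"] in \<open>simp_all add: add.commute\<close>)
    ultimately have "runs dot_body (S k) (1 + (1 + 2 * W) + (1 + 2 * W)) (S (Suc k))"
      unfolding dot_body_def by (rule runs_Seq)
    then show "eval_expr (Minus (Cell 0) (Cell (-3))) (S k) > 0
      \<and> runs dot_body (S k) (1 + (1 + 2 * W) + (1 + 2 * W)) (S (Suc k))"
      using k by (simp add: S_def w0)
  next
    show "eval_expr (Minus (Cell 0) (Cell (-3))) (S n) \<le> 0" by (simp add: S_def w0)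
  next
    fix k assume "k \<le> n"
    then show "cost_expr (Minus (Cell 0) (Cell (-3))) (S k) \<le> W"
      unfolding S_def using dot_le by (intro cost) auto
  qed
  then show ?thesis by (simp add: S_def dot_def algebra_simps)
qed

lemma run_row_body:
  assumes ij: "i < m" "j < i"
  shows "runs row_body (store_state w i j 0 0 (partial i j)) (15 * W * (n + 1))
    (store_state w i (Suc j) 0 0 (partial i (Suc j)))"
proof -
  have u: "\<bar>partial i j\<bar> \<le> cap" "\<bar>partial i (Suc j)\<bar> \<le> cap"
    using ij by (auto intro!: abs_partial_le)
  have d: "\<bar>dot i j n\<bar> \<le> cap"
    using abs_dot_le[of i j n] counter_bounds(1)[of n] ij by linarith
  have cost: "cost_expr e (store_state w i j k d u) \<le> W"
    if "const_bound 8 e" "expr_size e \<le> 40" "\<bar>k\<bar> \<le> cap" "\<bar>d\<bar> \<le> cap" "\<bar>u\<bar> \<le> cap" for e k d u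
    using that ij counter_bounds by (intro cost_le_W) auto
  have nxt: "partial i j + (dot i j n * dot i j n - int n) = partial i (Suc j)"
    by (simp add: partial_def excess_def)
  have "runs row_body (store_state w i j 0 0 (partial i j))
     (1 + (n * (5 + 5 * W) + 1 + W) + (1 + (1 + 2 * W) + (1 + (1 + 2 * W) + (1 + (1 + 2 * W) + (1 + 2 * W)))))
     (store_state w i (Suc j) 0 0 (partial i (Suc j)))"
    unfolding row_body_def
    by (rule runs_Seq[OF run_dot_loop[OF ij u(1)]],
        rule runs_Seq[where s' = "store_state w i j n (dot i j n) (partial i (Suc j))"],
        rule runs_Store, (rule cost; use u d counter_bounds in auto)+, (simp add: w0 nxt),
        rule runs_Seq[where s' = "store_state w i j n 0 (partial i (Suc j))"],
        rule runs_Store, (rule cost; use u d counter_bounds in auto)+, simp,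
        rule runs_Seq[where s' = "store_state w i j 0 0 (partial i (Suc j))"],
        rule runs_Store, (rule cost; use u d counter_bounds in auto)+, simp,
        rule runs_Store, (rule cost; use u d counter_bounds in auto)+, simp add: add.commute)
  then show ?thesis
    by (rule runs_mono) (simp add: W_def ring_distribs)
qed

lemma run_pair_body:
  assumes i: "i < m"
  shows "runs pair_body (store_state w i 0 0 0 (partial i 0)) (25 * W * (n + 1) * (m + 1))
    (store_state w (Suc i) 0 0 0 (partial (Suc i) 0))"
proof -
  have cost: "cost_expr e (store_state w i j 0 0 u) \<le> W"
    if "const_bound 8 e" "expr_size e \<le> 40" "\<bar>j\<bar> \<le> cap" "\<bar>u\<bar> \<le> cap" for e j u
    using that i counter_bounds by (intro cost_le_W) auto
  have u: "\<bar>partial i j\<bar> \<le> cap" if "j \<le> i" for j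
    using i that by (auto intro!: abs_partial_le)
  have j: "\<bar>int j\<bar> \<le> cap" if "j \<le> i" for j
    using counter_bounds(2)[of j] i that by simp
  define S where "S j = store_state w i (int j) 0 0 (partial i j)" for j
  have "runs (While (Minus (Cell (-1)) (Cell (-2))) row_body) (S 0)
    (i * (2 + W + 15 * W * (n + 1)) + 1 + W) (S i)"
  proof (rule runs_While)
    fix j assume "j < i"
    then show "eval_expr (Minus (Cell (-1)) (Cell (-2))) (S j) > 0
      \<and> runs row_body (S j) (15 * W * (n + 1)) (S (Suc j))"
      using run_row_body[OF i, of j] by (simp add: S_def)
  next
    fix k assume "k \<le> i"
    then show "cost_expr (Minus (Cell (-1)) (Cell (-2))) (S k) \<le> W"
      unfolding S_def using u j by (intro cost) auto
  qed (simp add: S_def)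
  then have loop: "runs (While (Minus (Cell (-1)) (Cell (-2))) row_body)
     (store_state w i 0 0 0 (partial i 0))
     (i * (2 + W + 15 * W * (n + 1)) + 1 + W) (store_state w i i 0 0 (partial i i))"
    by (simp add: S_def)
  \<comment> \<open>A completed row is the starting point of the next one.\<close>
  have nxt: "partial i i = partial (Suc i) 0" by (simp add: partial_def)
  have "runs pair_body (store_state w i 0 0 0 (partial i 0))
     (1 + (i * (2 + W + 15 * W * (n + 1)) + 1 + W) + (1 + (1 + 2 * W) + (1 + 2 * W)))
     (store_state w (Suc i) 0 0 0 (partial (Suc i) 0))"
    unfolding pair_body_def
    by (rule runs_Seq[OF loop],
        rule runs_Seq[where s' = "store_state w i 0 0 0 (partial i i)"],
        rule runs_Store, (rule cost; use u j in auto)+, simp,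
        rule runs_Store, (rule cost; use u j in auto)+, simp add: nxt add.commute)
  then show ?thesis
  proof (rule runs_mono)
    have W: "12 \<le> W" by (simp add: W_def)
    have "i * (2 + W + 15 * W * (n + 1)) \<le> m * (17 * W * (n + 1))"
      using i W by (intro mult_mono) auto
    then show "1 + (i * (2 + W + 15 * W * (n + 1)) + 1 + W) + (1 + (1 + 2 * W) + (1 + 2 * W))
      \<le> 25 * W * (n + 1) * (m + 1)"
      using W by (simp add: algebra_simps)
  qed
qed

lemma run_tester:
  "\<exists>s. runs tester_prog w (30 * W * (1 + m * (n + 1) * (m + 1))) s \<and>
    (s 0 = 1 \<longleftrightarrow> (\<Sum>i<m. \<Sum>j<i. excess i j) * (int n)\<^sup>2 * (w 2)\<^sup>2 * (w 5)\<^sup>2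
      \<le> int m * (int m - 1) * (w 4)\<^sup>2 * (w 3)\<^sup>2)"
proof -
  define S where "S i = store_state w (int i) 0 0 0 (partial i 0)" for i
  have cost: "cost_expr e (S i) \<le> W" if "const_bound 8 e" "expr_size e \<le> 40" "i \<le> m" for e i
    unfolding S_def using that counter_bounds(2)[of i] abs_partial_le[of i 0]
    by (intro cost_le_W) auto
  have "runs (While (Minus (Cell 1) (Cell (-1))) pair_body) (S 0)
    (m * (2 + W + 25 * W * (n + 1) * (m + 1)) + 1 + W) (S m)"
  proof (rule runs_While)
    fix i assume "i < m"
    then show "eval_expr (Minus (Cell 1) (Cell (-1))) (S i) > 0
      \<and> runs pair_body (S i) (25 * W * (n + 1) * (m + 1)) (S (Suc i))"
      using run_pair_body[of i] by (simp add: S_def w1)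
  next
    fix i assume "i \<le> m"
    then show "cost_expr (Minus (Cell 1) (Cell (-1))) (S i) \<le> W" by (intro cost) auto
  qed (simp add: S_def w1)
  \<comment> \<open>The working variables need no initialisation, since cells at negative addresses
    start at 0.\<close>
  moreover have "S 0 = w"
    by (simp add: S_def store_state_def partial_def fun_eq_iff w_neg)
  ultimately have loop: "runs (While (Minus (Cell 1) (Cell (-1))) pair_body) w
    (m * (2 + W + 25 * W * (n + 1) * (m + 1)) + 1 + W) (S m)" by simp
  define z where "z = (if eval_expr verdict (S m) > 0 then 0 else 1 :: int)"
  define s where "s = (S m)(0 := z)"
  have "runs (if eval_expr verdict (S m) > 0 then Store (Const 0) (Const 0) else Store (Const 0) (Const 1))
    (S m) (1 + 2 * W) s"
  proof (cases "eval_expr verdict (S m) > 0")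
    case True
    show ?thesis unfolding if_P[OF True]
      by (rule runs_Store[OF cost cost]) (use True in \<open>simp_all add: s_def z_def\<close>)
  next
    case False
    show ?thesis unfolding if_not_P[OF False]
      by (rule runs_Store[OF cost cost]) (use False in \<open>simp_all add: s_def z_def\<close>)
  qed
  then have "runs (If verdict (Store (Const 0) (Const 0)) (Store (Const 0) (Const 1))) (S m)
    (1 + W + (1 + 2 * W)) s"
    by (intro runs_If cost) (auto simp: verdict_def)
  then have "runs tester_prog w
    (1 + (m * (2 + W + 25 * W * (n + 1) * (m + 1)) + 1 + W) + (1 + W + (1 + 2 * W))) s"
    unfolding tester_prog_def by (rule runs_Seq[OF loop])
  then have "runs tester_prog w (30 * W * (1 + m * (n + 1) * (m + 1))) s"
  proof (rule runs_mono)
    have W: "12 \<le> W" by (simp add: W_def)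
    have "m * (2 + W) \<le> m * (2 * W)" using W by (intro mult_mono) auto
    then show "1 + (m * (2 + W + 25 * W * (n + 1) * (m + 1)) + 1 + W) + (1 + W + (1 + 2 * W))
      \<le> 30 * W * (1 + m * (n + 1) * (m + 1))"
      using W by (simp add: ring_distribs)
  qed
  moreover have "s 0 = 1 \<longleftrightarrow> (\<Sum>i<m. \<Sum>j<i. excess i j) * (int n)\<^sup>2 * (w 2)\<^sup>2 * (w 5)\<^sup>2
      \<le> int m * (int m - 1) * (w 4)\<^sup>2 * (w 3)\<^sup>2"
    by (simp add: s_def z_def verdict_def S_def w0 w1 partial_def power2_eq_square mult_ac)
  ultimately show ?thesis by blast
qed

end

lemma length_concat_rows: "length (concat (map (\<lambda>x. map x [0..<n]) xs)) = length xs * n"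
  by (induction xs) auto

lemma nth_concat_rows:
  "i < length xs \<Longrightarrow> l < n \<Longrightarrow> concat (map (\<lambda>x. map x [0..<n]) xs) ! (i * n + l) = (xs ! i) l"
proof (induction xs arbitrary: i)
  case (Cons x xs)
  then show ?case by (cases i) (auto simp: nth_append)
qed simp

text \<open>Every input cell is charged at least one bit, so \<open>m * n\<close> is at most the
  input size \<open>N\<close>, and \<open>n \<ge> 1\<close> gives the same for \<open>m\<close>. The
  nested loops thus make O(N^2) steps, each of cost O(N).\<close>

lemma poly_time_tester_tester: "poly_time_tester tester"
  unfolding poly_time_tester_def Let_def
\<comment> \<open>1200000 is 30 * 8000 * 5: the factor of \<open>run_tester\<close>, the bound
  \<open>8000 * N\<close> on \<open>W\<close>, and the bound \<open>5 * N ^ 2\<close> on the loop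
  count.\<close>
proof (rule exI[of _ tester_prog], rule exI[of _ 1200000], rule exI[of _ 3], intro allI impI)
  fix n :: nat and b e :: rat and xs :: "(nat \<Rightarrow> int) list"
  assume n: "1 \<le> n" and xs: "set xs \<subseteq> configs n"
  define v where "v = input_word n b e xs"
  define w where "w = initial_memory v"
  define m where "m = length xs"
  define N where "N = input_size v"
  have len: "length v = 6 + m * n"
    by (simp add: v_def input_word_def length_concat_rows m_def)
  have bits_le_N: "bits z \<le> N" if "z \<in> set v" for z
    unfolding N_def input_size_def using that by (intro member_le_sum_list) auto
  have len_N: "length v \<le> N"
  proof -
    have "sum_list (map (\<lambda>_. 1) v) \<le> sum_list (map bits v)"
      by (rule sum_list_mono) (simp add: bits_def)
    then show ?thesis by (simp add: N_def input_size_def sum_list_triv)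
  qed
  have abs_w: "\<bar>w a\<bar> \<le> 2 ^ N" for a
  proof (cases "0 \<le> a \<and> a < int (length v)")
    case True
    then have in_v: "v ! nat a \<in> set v" by (intro nth_mem) auto
    have "\<bar>v ! nat a\<bar> < 2 ^ bits (v ! nat a)" by (rule abs_less_bits)
    also have "\<dots> \<le> (2::int) ^ N" using bits_le_N[OF in_v] by (intro power_increasing) auto
    finally show ?thesis using True by (simp add: w_def initial_memory_def)
  qed (auto simp: w_def initial_memory_def)
  have w: "w 0 = int n" "w 1 = int m" "w 2 = fst (quotient_of b)" "w 3 = snd (quotient_of b)"
      "w 4 = fst (quotient_of e)" "w 5 = snd (quotient_of e)"
    by (simp_all add: w_def initial_memory_def v_def input_word_def m_def)
  \<comment> \<open>Both \<open>m\<close> and \<open>n\<close> are at most \<open>2 ^ N\<close>, so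
    the product of their squares needs \<open>4 * N\<close> bits; the 3 ensures the minimal
    budget.\<close>
  interpret tester_run w n m "4 * N + 3" "\<lambda>i. xs ! i"
  proof
    show "w 0 = int n" "w 1 = int m" by (rule w)+
    show "w a = 0" if "a < 0" for a using that by (simp add: w_def initial_memory_def)
    show "w (6 + (int i * int n + int l)) = (xs ! i) l" if "i < m" "l < n" for i l
    proof -
      have "i * n + l < m * n"
      proof -
        have "i * n + l < Suc i * n" using that by simp
        also have "\<dots> \<le> m * n" using that by (intro mult_le_mono1) simp
        finally show ?thesis .
      qed
      moreover from this have "int i * int n + int l < int m * int n"
        by (metis of_nat_add of_nat_less_iff of_nat_mult)
      moreover have "nat (6 + (int i * int n + int l)) = 6 + (i * n + l)"
        by (simp add: nat_add_distrib nat_mult_distrib)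
      moreover have "v ! (6 + (i * n + l)) = (xs ! i) l"
        using nth_concat_rows[of i xs l n] that
        by (simp add: v_def input_word_def m_def nth_append numeral_eq_Suc)
      ultimately show ?thesis
        by (simp add: w_def initial_memory_def len)
    qed
    show "\<bar>(xs ! i) l\<bar> \<le> 1" if "i < m" "l < n" for i l
    proof -
      have "xs ! i \<in> configs n" using xs that by (auto simp: m_def)
      then have "(xs ! i) l \<in> {-1, 1}" using that by (auto simp: configs_def PiE_iff)
      then show ?thesis by auto
    qed
    show "3 \<le> 4 * N + 3" by simp
    have mono: "(2::int) ^ N \<le> 2 ^ (4 * N + 3)" by (intro power_increasing) auto
    show "\<bar>w a\<bar> \<le> 2 ^ (4 * N + 3)" for a using abs_w[of a] mono by linarith
    have nm: "int n \<le> 2 ^ N" "int m \<le> 2 ^ N" using abs_w[of 0] abs_w[of 1] w by auto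
    have "int m * int m * (int n * int n) \<le> 2 ^ N * 2 ^ N * (2 ^ N * 2 ^ N)"
      using nm by (intro mult_mono) auto
    also have "\<dots> = 2 ^ (4 * N)" by (simp add: power_add[symmetric])
    also have "\<dots> \<le> (2::int) ^ (4 * N + 3)" by (intro power_increasing) auto
    finally show "int m * int m * (int n * int n) \<le> 2 ^ (4 * N + 3)" .
  qed
  obtain s where s: "runs tester_prog w (30 * W * (1 + m * (n + 1) * (m + 1))) s"
    and out: "s 0 = 1 \<longleftrightarrow> (\<Sum>i<m. \<Sum>j<i. excess i j) * (int n)\<^sup>2 * (w 2)\<^sup>2 * (w 5)\<^sup>2
      \<le> int m * (int m - 1) * (w 4)\<^sup>2 * (w 3)\<^sup>2"
    using run_tester by blast
  have "tester n b e xs \<longleftrightarrow> s 0 = 1"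
    unfolding out tester_def w m_def[symmetric]
    by (simp add: pair_sum_def overlap_excess_def excess_def dot_def m_def power2_eq_square)
  moreover have "30 * W * (1 + m * (n + 1) * (m + 1)) \<le> 1200000 * N ^ 3"
  proof -
    have N6: "6 \<le> N" and mn: "m * n \<le> N" using len_N len by simp_all
    have "m * 1 \<le> m * n" using n by (intro mult_le_mono2) simp
    then have mN: "m \<le> N" using mn by linarith
    have "W \<le> 8000 * N" using N6 by (simp add: W_def)
    have 1: "m * (n + 1) \<le> 2 * N" using mn mN by simp
    have "m * (n + 1) * (m + 1) \<le> (2 * N) * (2 * N)"
      using mN N6 by (intro mult_mono 1) auto
    moreover have "1 \<le> N * N" using N6 by simp
    ultimately have 2: "1 + m * (n + 1) * (m + 1) \<le> 5 * N ^ 2"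
      unfolding power2_eq_square by linarith
    have "30 * W * (1 + m * (n + 1) * (m + 1)) \<le> 30 * (8000 * N) * (5 * N ^ 2)"
      using \<open>W \<le> 8000 * N\<close> by (intro mult_mono 2) auto
    then show ?thesis by (simp add: power2_eq_square power3_eq_cube)
  qed
  ultimately show "\<exists>t s. exec tester_prog (initial_memory (input_word n b e xs)) t s
      \<and> t \<le> 1200000 * input_size (input_word n b e xs) ^ 3 \<and> (tester n b e xs \<longleftrightarrow> s 0 = 1)"
    using s unfolding runs_def w_def v_def N_def by (meson order_trans)
qed

theorem theorem6:
  fixes \<eta> :: real
  assumes "\<eta> > 0"
  shows "\<exists>A C k. poly_time_tester A \<and>
    (\<forall>(n::nat) (\<beta>::real) (\<epsilon>::real) (b::rat) (e::rat) (m::nat) (\<theta> :: nat \<Rightarrow> nat \<Rightarrow> real).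
       n \<ge> 1 \<longrightarrow> \<beta> \<ge> 0 \<longrightarrow> \<epsilon> > 0 \<longrightarrow> approx_params \<beta> \<epsilon> b e \<longrightarrow>
       real m \<ge> soft_O C k (real n powr (10/3) * \<beta>\<^sup>2 / \<epsilon>\<^sup>2) \<longrightarrow>
       (\<forall>u<n. \<forall>v<n. \<theta> u v = \<theta> v u) \<longrightarrow>
       (\<forall>u<n. \<forall>v<n. u \<noteq> v \<longrightarrow> \<bar>\<theta> u v\<bar> \<le> \<beta>) \<longrightarrow>
       high_temperature n \<eta> \<theta> \<longrightarrow>
       (let p = ising n (\<lambda>_. 0) \<theta> in
          (p \<in> product_dists n \<longrightarrow>
             measure_pmf.prob (replicate_pmf m p) {xs. A n b e xs} \<ge> 9/10) \<and>
          (d_SKL_set p (product_dists n) \<ge> ereal \<epsilon> \<longrightarrow>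
             measure_pmf.prob (replicate_pmf m p) {xs. \<not> A n b e xs} \<ge> 9/10)))"
proof -
  \<comment> \<open>The first term controls both error probabilities, the second forces two samples
    in the far case, and the third allows a factor \<open>1 / C\<close> to be dropped.\<close>
  define C where "C = 327680 / \<eta>\<^sup>2 + 1 / \<eta> + 1"
  have C: "1 \<le> C" "1 / \<eta> \<le> C" "327680 / \<eta>\<^sup>2 \<le> C" "2560 / \<eta>\<^sup>2 \<le> C"
  proof -
    have "0 < 1 / \<eta>" "0 < 1 / \<eta>\<^sup>2" using assms by simp_all
    then show "1 \<le> C" "1 / \<eta> \<le> C" "327680 / \<eta>\<^sup>2 \<le> C" "2560 / \<eta>\<^sup>2 \<le> C"
      by (simp_all add: C_def field_simps)
  qed
  \<comment> \<open>For \<open>n \<ge> 1\<close> the cube lies below the power 10/3, so the log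
    exponent can be taken as 0.\<close>
  have samples: "C * (real n ^ 3 * \<beta>\<^sup>2 / \<epsilon>\<^sup>2) \<le> real m"
    if "n \<ge> 1" "real m \<ge> soft_O C 0 (real n powr (10/3) * \<beta>\<^sup>2 / \<epsilon>\<^sup>2)" for n m \<beta> \<epsilon>
  proof -
    have "real n ^ 3 = real n powr 3" using that by simp
    also have "\<dots> \<le> real n powr (10/3)" using that by (intro powr_mono) auto
    finally have "C * (real n ^ 3 * \<beta>\<^sup>2 / \<epsilon>\<^sup>2) \<le> C * (real n powr (10/3) * \<beta>\<^sup>2 / \<epsilon>\<^sup>2)"
      using C by (intro mult_left_mono divide_right_mono mult_right_mono) auto
    then show ?thesis using that by (simp add: soft_O_def)
  qed
  show ?thesis
    unfolding Let_def
    by (intro exI[of _ tester] exI[of _ C] exI[of _ 0] conjI allI impI poly_time_tester_tester;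
        (rule tester_accepts_product[OF _ assms] | rule tester_rejects_far[OF _ assms]))
      (use C samples in auto)
qed

end
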